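(* Let $G$ be a simple connected graph of minimum degree at least $4$ and let $x$ be a vertex of $G$. Then $G$ contains an induced subgraph $H$ isomorphic to a subdivision of a wheel, or of the prism $K_2 \times K_3$, or of $K_{3,3}$, such that $G-V(H)$ is connected and contains $x$.
   Context: The wheel $W_\ell$ ($\ell \ge 3$) is obtained from a cycle of length $\ell$ by adding a new vertex adjacent to all vertices of the cycle; in particular $W_3 \cong K_4$. A subdivision of a graph $P$ is obtained by replacing edges of $P$ by internally disjoint paths. $K_2 \times K_3$ is the prism (two disjoint triangles joined by a perfect matching). *)

theory Defs
  imports "Graph_Theory.Graph_Theory"
begin

text \<open>
  Finite simple graphs are represented, as in \<^theory>\<open>Graph_Theory.Kuratowski\<close>, by their symmetric
  digraphs: every edge corresponds to two opposite arcs, and the degree of a vertex is its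
  \<^const>\<open>out_degree\<close>. Like \<^const>\<open>complete_bipartite_digraph\<close>, the predicates below are invariant
  under isomorphism.
\<close>

definition wheel :: "nat \<Rightarrow> ('a, 'b) pre_digraph \<Rightarrow> bool" where
  "wheel l G \<longleftrightarrow> 3 \<le> l \<and> graph G \<and>
    (\<exists>c h. inj_on c {..<l} \<and> h \<notin> c ` {..<l} \<and>
      verts G = insert h (c ` {..<l}) \<and>
      arcs_ends G = (\<Union>i<l. {(c i, c (Suc i mod l)), (c (Suc i mod l), c i), (h, c i), (c i, h)}))"

definition prism :: "('a, 'b) pre_digraph \<Rightarrow> bool" where
  "prism G \<longleftrightarrow> graph G \<and>
    (\<exists>a b. inj_on a {..<3::nat} \<and> inj_on b {..<3::nat} \<and> a ` {..<3} \<inter> b ` {..<3} = {} \<and>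
      verts G = a ` {..<3} \<union> b ` {..<3} \<and>
      arcs_ends G = {(a i, a j) | i j. i < 3 \<and> j < 3 \<and> i \<noteq> j} \<union>
                    {(b i, b j) | i j. i < 3 \<and> j < 3 \<and> i \<noteq> j} \<union>
                    (\<Union>i<3. {(a i, b i), (b i, a i)}))"

end

theory Submission
  imports Defs
begin

text \<open>
  Among the connected vertex sets \<open>A\<close> containing \<open>x\<close> for which \<open>G - A\<close> is not series-parallel,
  take a largest one, and let \<open>H = G - A\<close>. Every vertex of \<open>H\<close> with a neighbour in \<open>A\<close> is critical:
  deleting it makes \<open>H\<close> series-parallel. All other vertices keep their degree, which is at
  least 4. A vertex of degree at most 2 in \<open>H\<close> is therefore critical, so it has two nonadjacent
  neighbours and can be suppressed. This leaves a graph of minimum degree at least 3 in which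
  every cubic vertex is critical.

  A series-parallel graph cannot have all degrees at least 3 outside a vertex or an edge. Applying
  this after deleting a cubic vertex \<open>s\<close> and suppressing some of its neighbours determines the
  graph. If two cubic vertices lie in a triangle with a vertex of larger degree, this vertex is
  the hub of a wheel; a triangle of cubic vertices gives a prism (or the complete graph on four
  vertices); and if no cubic vertex lies in a triangle, then all vertices are cubic and any two
  neighbours of \<open>s\<close> have the same neighbours, which gives \<open>K\<^sub>3\<^sub>,\<^sub>3\<close>.
\<close>

section \<open>Series-parallel reduction\<close>

locale simple_graph =
  fixes V :: "'a set" and E :: "'a rel"
  assumes finV: "finite V"
    and E_sub: "E \<subseteq> V \<times> V"
    and E_sym: "(x, y) \<in> E \<Longrightarrow> (y, x) \<in> E"
    and E_irrefl: "(x, x) \<notin> E"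
begin

lemma in_V: "(x, y) \<in> E \<Longrightarrow> x \<in> V \<and> y \<in> V"
  using E_sub by auto

lemma nbrs_sub: "E `` {v} \<subseteq> V"
  using E_sub by auto

lemma fin_nbrs [simp]: "finite (E `` {v})"
  using nbrs_sub finV by (rule finite_subset)

lemma E_eq_Union: "E = (\<Union>v\<in>V. {v} \<times> E `` {v})"
  using E_sub by auto

lemma nbrs_iff:
  assumes "E `` {v} = A"
  shows "(v, y) \<in> E \<longleftrightarrow> y \<in> A" "(y, v) \<in> E \<longleftrightarrow> y \<in> A"
  using assms E_sym by auto

lemma nbrs_not_self: "E `` {v} = A \<Longrightarrow> v \<notin> A"
  using E_irrefl by auto

end

definition vertex_del :: "'a \<Rightarrow> 'a rel \<Rightarrow> 'a rel" where
  "vertex_del w E = {(x, y) \<in> E. x \<noteq> w \<and> y \<noteq> w}"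

text \<open>One formula covers the reductions at every degree up to 2: plain deletion for degree 0
  or 1, suppression for degree 2. The condition \<open>x \<noteq> y\<close> prevents loops, and a
  new edge parallel to an old one merges with it.\<close>

definition vertex_elim :: "'a \<Rightarrow> 'a rel \<Rightarrow> 'a rel" where
  "vertex_elim w E =
    {(x, y). x \<noteq> w \<and> y \<noteq> w \<and> x \<noteq> y \<and> ((x, y) \<in> E \<or> (x, w) \<in> E \<and> (w, y) \<in> E)}"

lemma in_vertex_del [simp]: "(x, y) \<in> vertex_del w E \<longleftrightarrow> (x, y) \<in> E \<and> x \<noteq> w \<and> y \<noteq> w"
  by (auto simp: vertex_del_def)

lemma in_vertex_elim [simp]:
  "(x, y) \<in> vertex_elim w E \<longleftrightarrow>
    x \<noteq> w \<and> y \<noteq> w \<and> x \<noteq> y \<and> ((x, y) \<in> E \<or> (x, w) \<in> E \<and> (w, y) \<in> E)"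
  by (auto simp: vertex_elim_def)

lemma (in simple_graph) simple_graph_del: "simple_graph (V - {w}) (vertex_del w E)"
  using finV E_sub E_sym E_irrefl by unfold_locales auto

lemma (in simple_graph) simple_graph_elim: "simple_graph (V - {w}) (vertex_elim w E)"
  using finV E_sub E_sym E_irrefl by unfold_locales auto

lemma vertex_elim_del_commute:
  "s \<noteq> w \<Longrightarrow> vertex_elim w (vertex_del s E) = vertex_del s (vertex_elim w E)"
  by auto

text \<open>
  Eliminating a vertex of degree at most 2 is a series-parallel reduction, so \<open>thick\<close> says that
  the graph is not series-parallel, i.e.\ contains a subdivision of the complete graph on four
  vertices. Only exact reductions of vertices of degree at most 2 occur in the definition; as a
  result neither minors nor the confluence of the reductions are ever needed.
\<close>

inductive thick :: "'a set \<Rightarrow> 'a rel \<Rightarrow> bool" where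
  base: "V \<noteq> {} \<Longrightarrow> \<forall>v\<in>V. 3 \<le> card (E `` {v}) \<Longrightarrow> thick V E"
| elim: "w \<in> V \<Longrightarrow> card (E `` {w}) \<le> 2 \<Longrightarrow> thick (V - {w}) (vertex_elim w E) \<Longrightarrow> thick V E"

lemma card_le_2_cases:
  assumes "finite A" "card A \<le> 2"
  obtains "A = {}" | p where "A = {p}" | p q where "p \<noteq> q" "A = {p, q}"
proof -
  have "card A = 0 \<or> card A = 1 \<or> card A = 2" using assms by linarith
  then show thesis
    using assms(1) that by (auto simp: card_1_singleton_iff card_2_iff)
qed

text \<open>
  A set attached to the rest of the graph at an edge or a single vertex: eliminating an attachment
  vertex leaves a set attached at its (now adjacent) neighbours.
\<close>

lemma thick_attached:
  assumes "simple_graph V E" "Y \<subseteq> V" "Y \<noteq> {}" "u = v \<or> (u, v) \<in> E" "u \<notin> Y" "v \<notin> Y"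
    and "\<And>y. y \<in> Y \<Longrightarrow> 3 \<le> card (E `` {y})"
    and "\<And>y. y \<in> Y \<Longrightarrow> E `` {y} \<subseteq> Y \<union> {u, v}"
  shows "thick V E"
  using assms
proof (induction "card V" arbitrary: V E Y u v rule: less_induct)
  case less
  interpret simple_graph V E by fact
  note deg = less.prems(7) and closed = less.prems(8)
  show ?case
  proof (cases "\<forall>v\<in>V. 3 \<le> card (E `` {v})")
    case True
    then show ?thesis using less.prems(2,3) by (auto intro: thick.base)
  next
    case False
    then obtain w where w: "w \<in> V" "card (E `` {w}) \<le> 2" by force
    then have "w \<notin> Y" using deg by force
    define V' where "V' = V - {w}"
    define E' where "E' = vertex_elim w E"
    have smaller: "card V' < card V"
      unfolding V'_def using finV w(1) by (rule card_Diff1_less)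
    interpret G': simple_graph V' E'
      unfolding V'_def E'_def by (rule simple_graph_elim)
    have unchanged: "E' `` {y} = E `` {y}" if "y \<noteq> w" "(y, w) \<notin> E" for y
      using that E_irrefl by (auto simp: E'_def)
    have "thick V' E'"
    proof (cases "w \<in> {u, v}")
      case False
      \<comment> \<open>A vertex \<open>w\<close> outside \<open>Y\<close> that is no attachment
        vertex has no neighbour in \<open>Y\<close>, so \<open>Y\<close>, \<open>u\<close> and
        \<open>v\<close> carry over unchanged.\<close>
      have E'_Y: "E' `` {y} = E `` {y}" if "y \<in> Y" for y
        using closed[OF that] that False \<open>w \<notin> Y\<close> by (intro unchanged) auto
      show ?thesis
        using less.prems(2-6) False \<open>w \<notin> Y\<close> deg closed E_irrefl
        by (intro less.hyps[of V' E' Y u v] smaller G'.simple_graph_axioms)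
           (auto simp: E'_Y V'_def, auto simp: E'_def)
    next
      case True
      \<comment> \<open>The neighbours \<open>p\<close>, \<open>q\<close> of \<open>w\<close> become
        the new attachment: elimination joins them, and if one of \<open>u\<close>, \<open>v\<close>
        differs from \<open>w\<close>, it is among them. With a single neighbour
        \<open>p = q\<close>; with none, \<open>w\<close> itself is a dummy for both.\<close>
      have "\<exists>p q. E `` {w} \<subseteq> {p, q} \<and> (p = q \<or> (p, q) \<in> E') \<and> {u, v} \<subseteq> {w, p, q}"
        using fin_nbrs w(2)
      proof (cases rule: card_le_2_cases)
        case 1
        then have "E `` {w} \<subseteq> {w, w} \<and> (w = w \<or> (w, w) \<in> E') \<and> {u, v} \<subseteq> {w, w, w}"
          using less.prems(4) True E_sym by auto
        then show ?thesis by blast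
      next
        case (2 p)
        have "(w, y) \<in> E \<longleftrightarrow> y = p" "(y, w) \<in> E \<longleftrightarrow> y = p" for y
          using nbrs_iff[OF 2] by simp_all
        then have "E `` {w} \<subseteq> {p, p} \<and> (p = p \<or> (p, p) \<in> E') \<and> {u, v} \<subseteq> {w, p, p}"
          using less.prems(4) True by auto
        then show ?thesis by blast
      next
        case (3 p q)
        have "(w, y) \<in> E \<longleftrightarrow> y = p \<or> y = q" "(y, w) \<in> E \<longleftrightarrow> y = p \<or> y = q" for y
          using nbrs_iff[OF 3(2)] by simp_all
        then have "E `` {w} \<subseteq> {p, q} \<and> (p = q \<or> (p, q) \<in> E') \<and> {u, v} \<subseteq> {w, p, q}"
          using less.prems(4) True E_irrefl 3(1) by (auto simp: E'_def)
        then show ?thesis by blast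
      qed
      then obtain p q where pq: "E `` {w} \<subseteq> {p, q}" "p = q \<or> (p, q) \<in> E'" "{u, v} \<subseteq> {w, p, q}"
        by blast
      define Y' where "Y' = Y - {p, q}"
      have E'_Y: "E' `` {y} = E `` {y}" "w \<notin> E `` {y}" if "y \<in> Y'" for y
        using that pq(1) E_sym \<open>w \<notin> Y\<close> by (auto simp: Y'_def intro!: unchanged)
      \<comment> \<open>If \<open>p\<close> and \<open>q\<close> exhausted \<open>Y\<close>, a
        vertex of \<open>Y\<close> would have all its neighbours among the others of
        \<open>p\<close>, \<open>q\<close>, \<open>w\<close>, which is at most two.\<close>
      have "Y' \<noteq> {}"
      proof
        assume "Y' = {}"
        then obtain y where y: "y \<in> Y" "y \<in> {p, q}" using less.prems(3) by (auto simp: Y'_def)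
        have "E `` {y} \<subseteq> {p, q, w} - {y}"
          using closed[OF y(1)] \<open>Y' = {}\<close> pq(3) E_irrefl by (auto simp: Y'_def)
        then have "card (E `` {y}) \<le> card ({p, q, w} - {y})" by (intro card_mono) auto
        also have "\<dots> \<le> 2" using y(2) by (auto simp: card_insert_if insert_Diff_if)
        finally show False using deg[OF y(1)] by simp
      qed
      moreover have "E' `` {y} \<subseteq> Y' \<union> {p, q}" "3 \<le> card (E' `` {y})" if "y \<in> Y'" for y
        using closed[of y] deg[of y] E'_Y[OF that] pq(3) that by (auto simp: Y'_def)
      ultimately show ?thesis
        using less.prems(2) \<open>w \<notin> Y\<close> pq(2)
        by (intro less.hyps[of V' E' Y' p q] smaller G'.simple_graph_axioms)
           (auto simp: Y'_def V'_def)
    qed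
    then show ?thesis unfolding V'_def E'_def by (rule thick.elim[OF w])
  qed
qed

text \<open>The form in which most contradictions arise below: after deleting a cubic vertex and
  eliminating some of its neighbours, degrees below 3 remain at most at one vertex
  (\<open>u = v\<close>) or at the two ends of an edge. The vertex \<open>y\<^sub>0\<close> ensures
  that something else is left.\<close>

corollary thick_two_exceptions:
  assumes "simple_graph V E" "u = v \<or> (u, v) \<in> E" "y\<^sub>0 \<in> V" "y\<^sub>0 \<notin> {u, v}"
    and "\<And>y. y \<in> V \<Longrightarrow> y \<notin> {u, v} \<Longrightarrow> 3 \<le> card (E `` {y})"
  shows "thick V E"
proof (rule thick_attached[of V E "V - {u, v}" u v])
  fix y
  show "E `` {y} \<subseteq> V - {u, v} \<union> {u, v}" using simple_graph.nbrs_sub[OF assms(1)] by auto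
qed (use assms in auto)

section \<open>Counting neighbours\<close>

text \<open>Degree bookkeeping: a neighbourhood \<open>A\<close> turns into \<open>B\<close>, losing
  at most \<open>P\<close> and gaining the new neighbours \<open>Q\<close>.\<close>

lemma card_exchange:
  assumes "finite B" "A - P \<union> Q \<subseteq> B" "Q \<inter> A = {}" "finite P" "finite Q"
  shows "card A + card Q \<le> card B + card P"
proof -
  have "finite (A - P)" using assms(1,2) by (auto intro: finite_subset)
  then have "card (A - P) + card Q = card (A - P \<union> Q)"
    using assms(3,5) by (subst card_Un_disjoint) auto
  also have "\<dots> \<le> card B" using assms(1,2) by (rule card_mono)
  finally show ?thesis
    using diff_card_le_card_Diff[OF assms(4), of A] by linarith
qed

corollary card_loss:
  assumes "finite B" "A - P \<subseteq> B" "finite P"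
  shows "card A \<le> card B + card P"
  using card_exchange[of B A P "{}"] assms by simp

lemma card_3_third:
  assumes "card A = 3" "p \<in> A" "q \<in> A" "p \<noteq> q"
  obtains r where "A = {p, q, r}" "r \<noteq> p" "r \<noteq> q"
proof -
  have "card (A - {p, q}) = 1"
    using assms by (simp add: card_Diff_subset)
  then obtain r where "A - {p, q} = {r}" by (auto simp: card_1_singleton_iff)
  then show thesis using that[of r] assms by auto
qed

lemma card_3_rest:
  assumes "card A = 3" "p \<in> A"
  obtains q r where "A = {p, q, r}" "q \<noteq> p" "r \<noteq> p" "r \<noteq> q"
proof -
  have "card (A - {p}) = 2" using assms by simp
  then obtain q r where "A - {p} = {q, r}" "q \<noteq> r" by (auto simp: card_2_iff)
  then show thesis using that[of q r] assms by auto
qed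

lemma card_3_eqI: "finite A \<Longrightarrow> card A = 3 \<Longrightarrow> {p, q, r} \<subseteq> A \<Longrightarrow> distinct [p, q, r] \<Longrightarrow> A = {p, q, r}"
  by (rule card_subset_eq[symmetric]) auto

section \<open>Recognising wheels and prisms\<close>

lemma (in simple_graph) pair_graph: "pair_graph \<lparr>pverts = V, parcs = E\<rparr>"
proof
  show "finite (parcs \<lparr>pverts = V, parcs = E\<rparr>)"
    using E_sub finV by (auto intro: finite_subset)
  show "symmetric (with_proj \<lparr>pverts = V, parcs = E\<rparr>)"
    using E_sym by (auto simp: symmetric_def intro: symI)
qed (use finV E_sub E_irrefl in auto)

lemma (in simple_graph) wheelI:
  assumes "3 \<le> l" "inj_on c {..<l}" "h \<notin> c ` {..<l}" "V = insert h (c ` {..<l})"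
    and "E = (\<Union>i<l. {(c i, c (Suc i mod l)), (c (Suc i mod l), c i), (h, c i), (c i, h)})"
  shows "wheel l (with_proj \<lparr>pverts = V, parcs = E\<rparr>)"
  unfolding wheel_def with_proj_simps pair_pre_digraph.select_convs
  using assms pair_graph.pair_graphD_graph[OF pair_graph] by blast

lemma (in simple_graph) prismI:
  assumes "distinct [a\<^sub>0, a\<^sub>1, a\<^sub>2, b\<^sub>0, b\<^sub>1, b\<^sub>2]" "V = {a\<^sub>0, a\<^sub>1, a\<^sub>2, b\<^sub>0, b\<^sub>1, b\<^sub>2}"
    and "E `` {a\<^sub>0} = {a\<^sub>1, a\<^sub>2, b\<^sub>0}" "E `` {a\<^sub>1} = {a\<^sub>0, a\<^sub>2, b\<^sub>1}" "E `` {a\<^sub>2} = {a\<^sub>0, a\<^sub>1, b\<^sub>2}"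
    and "E `` {b\<^sub>0} = {b\<^sub>1, b\<^sub>2, a\<^sub>0}" "E `` {b\<^sub>1} = {b\<^sub>0, b\<^sub>2, a\<^sub>1}" "E `` {b\<^sub>2} = {b\<^sub>0, b\<^sub>1, a\<^sub>2}"
  shows "prism (with_proj \<lparr>pverts = V, parcs = E\<rparr>)"
proof -
  define a b where "a i = [a\<^sub>0, a\<^sub>1, a\<^sub>2] ! i" and "b i = [b\<^sub>0, b\<^sub>1, b\<^sub>2] ! i" for i
  have ab: "a 0 = a\<^sub>0" "a 1 = a\<^sub>1" "a 2 = a\<^sub>2" "b 0 = b\<^sub>0" "b 1 = b\<^sub>1" "b 2 = b\<^sub>2"
    by (simp_all add: a_def b_def)
  have lt3: "{..<3::nat} = {0, 1, 2}" by auto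
  have pairs: "{(f i, f j) | i j. i < 3 \<and> j < 3 \<and> i \<noteq> j} =
      {f 0} \<times> {f 1, f 2} \<union> {f 1} \<times> {f 0, f 2} \<union> {f 2} \<times> {f 0, f 1}" for f :: "nat \<Rightarrow> 'a"
  proof -
    have "{(f i, f j) | i j. i < 3 \<and> j < 3 \<and> i \<noteq> j} = (\<Union>i<3. \<Union>j\<in>{..<3} - {i}. {(f i, f j)})"
      by blast
    also have "\<dots> = {f 0} \<times> {f 1, f 2} \<union> {f 1} \<times> {f 0, f 2} \<union> {f 2} \<times> {f 0, f 1}"
    proof -
      have "{0, 1, 2} - {0} = {1, 2 :: nat}" "{0, 1, 2} - {1} = {0, 2 :: nat}"
        "{0, 1, 2} - {2} = {0, 1 :: nat}" by auto
      then show ?thesis unfolding lt3 by (simp only: UN_insert UN_empty) blast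
    qed
    finally show ?thesis .
  qed
  have "E = (\<Union>x\<in>V. {x} \<times> E `` {x})" by (rule E_eq_Union)
  also have "\<dots> = {a\<^sub>0} \<times> {a\<^sub>1, a\<^sub>2, b\<^sub>0} \<union> ({a\<^sub>1} \<times> {a\<^sub>0, a\<^sub>2, b\<^sub>1} \<union> ({a\<^sub>2} \<times> {a\<^sub>0, a\<^sub>1, b\<^sub>2} \<union>
      ({b\<^sub>0} \<times> {b\<^sub>1, b\<^sub>2, a\<^sub>0} \<union> ({b\<^sub>1} \<times> {b\<^sub>0, b\<^sub>2, a\<^sub>1} \<union> {b\<^sub>2} \<times> {b\<^sub>0, b\<^sub>1, a\<^sub>2}))))"
    unfolding assms(2) by (simp only: UN_insert UN_empty Un_empty_right assms(3-))
  also have "\<dots> = {(a i, a j) | i j. i < 3 \<and> j < 3 \<and> i \<noteq> j} \<union>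
      {(b i, b j) | i j. i < 3 \<and> j < 3 \<and> i \<noteq> j} \<union> (\<Union>i<3. {(a i, b i), (b i, a i)})"
    unfolding pairs lt3 UN_insert UN_empty ab by blast
  finally have E: "E = \<dots>" .
  have V: "V = a ` {..<3} \<union> b ` {..<3}"
    unfolding lt3 image_insert image_empty ab assms(2) by blast
  have "a ` {..<3} \<inter> b ` {..<3} = {}"
    unfolding lt3 image_insert image_empty ab using assms(1) by auto
  moreover have "inj_on a {..<3}" "inj_on b {..<3}"
    unfolding lt3 using assms(1) ab by (auto simp: inj_on_def)
  ultimately show ?thesis
    unfolding prism_def with_proj_simps pair_pre_digraph.select_convs
    using E V pair_graph.pair_graphD_graph[OF pair_graph] by blast
qed

section \<open>Graphs in which every cubic vertex is critical\<close>

text \<open>What remains of \<open>H\<close> once its vertices of degree at most 2 have been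
  suppressed; the rest of this section shows that it is a wheel, the prism or the complete bipartite
  graph.\<close>

locale critical_graph = simple_graph +
  assumes min_deg: "v \<in> V \<Longrightarrow> 3 \<le> card (E `` {v})"
    and critical: "v \<in> V \<Longrightarrow> card (E `` {v}) = 3 \<Longrightarrow> \<not> thick (V - {v}) (vertex_del v E)"
    and ex_cubic: "\<exists>v\<in>V. card (E `` {v}) = 3"
begin

abbreviation cubic :: "'a \<Rightarrow> bool" where
  "cubic v \<equiv> card (E `` {v}) = 3"

lemma cubic_in_V: "cubic v \<Longrightarrow> v \<in> V"
  using E_sub by (cases "E `` {v} = {}") auto

lemma not_thick_del: "cubic v \<Longrightarrow> \<not> thick (V - {v}) (vertex_del v E)"
  using critical cubic_in_V by blast

text \<open>Once \<open>s\<close> is deleted, \<open>b\<close> has degree at most 2, so its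
  elimination is an admissible reduction and thickness would lift back, against criticality of
  \<open>s\<close>.\<close>

lemma not_thick_elim:
  assumes "cubic s" "cubic b" "(s, b) \<in> E"
  shows "\<not> thick (V - {s} - {b}) (vertex_elim b (vertex_del s E))"
proof
  assume thick: "thick (V - {s} - {b}) (vertex_elim b (vertex_del s E))"
  have "s \<in> E `` {b}" "b \<noteq> s" using assms(3) E_sym E_irrefl by auto
  moreover have "vertex_del s E `` {b} = E `` {b} - {s}" using \<open>b \<noteq> s\<close> by auto
  ultimately have "card (vertex_del s E `` {b}) \<le> 2" using assms(2) by simp
  moreover have "b \<in> V - {s}" using assms(2) cubic_in_V \<open>b \<noteq> s\<close> by auto
  ultimately show False using thick not_thick_del[OF assms(1)] thick.elim by metis
qed

lemma simple_graph_elim_del: "simple_graph (V - {s} - {b}) (vertex_elim b (vertex_del s E))"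
  using simple_graph.simple_graph_elim[OF simple_graph_del] .

lemma elim_del_nbrs:
  assumes "(y, s) \<notin> E" "(y, b) \<in> E" "(b, z) \<in> E" "y \<noteq> s" "z \<noteq> s" "y \<noteq> z" "b \<noteq> s"
  shows "E `` {y} - {b} \<union> {z} \<subseteq> vertex_elim b (vertex_del s E) `` {y}"
  using assms E_irrefl by auto

text \<open>A set hanging at the single vertex \<open>c\<close>, and neither containing
  \<open>s\<close> nor adjacent to it, keeps all its degrees when \<open>s\<close> is deleted. It
  alone would then make the remaining graph thick.\<close>

lemma attached_meets_cubic:
  assumes "Y \<subseteq> V" "Y \<noteq> {}" "c \<notin> Y" "\<And>y. y \<in> Y \<Longrightarrow> E `` {y} \<subseteq> insert c Y"
    and "cubic s" "s \<notin> Y" "\<And>y. y \<in> Y \<Longrightarrow> (y, s) \<notin> E"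
  shows False
proof -
  have eq: "vertex_del s E `` {y} = E `` {y}" if "y \<in> Y" for y
    using assms(6,7) that by auto
  have "thick (V - {s}) (vertex_del s E)"
  proof (rule thick_attached[of _ _ Y c c])
    fix y assume "y \<in> Y"
    then show "3 \<le> card (vertex_del s E `` {y})" "vertex_del s E `` {y} \<subseteq> Y \<union> {c, c}"
      using min_deg assms(1,4) by (auto simp: eq)
  qed (use assms simple_graph_del in auto)
  then show False using not_thick_del assms(5) by blast
qed

text \<open>Connectedness follows from criticality: a proper closed set and its complement are both
  closed, a cubic vertex \<open>s\<close> lies in one of them, and the other survives the deletion
  of \<open>s\<close> intact. Here \<open>s\<close> itself is passed as the attachment
  vertex.\<close>

lemma closed_eq_V:
  assumes "Y \<subseteq> V" "Y \<noteq> {}" "\<And>y. y \<in> Y \<Longrightarrow> E `` {y} \<subseteq> Y"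
  shows "Y = V"
proof (rule ccontr)
  assume "Y \<noteq> V"
  have closed': "E `` {y} \<subseteq> V - Y" if "y \<in> V - Y" for y
    using that assms(3) E_sym in_V by blast
  obtain s where s: "s \<in> V" "cubic s" using ex_cubic by blast
  show False
  proof (cases "s \<in> Y")
    case True
    show False
      using s(2) True \<open>Y \<noteq> V\<close> assms(1) closed'
      by (intro attached_meets_cubic[of "V - Y" s s]) blast+
  next
    case False
    show False
      using s(2) False assms
      by (intro attached_meets_cubic[of "Y" s s]) blast+
  qed
qed

lemma ge_4: "v \<in> V \<Longrightarrow> \<not> cubic v \<Longrightarrow> 4 \<le> card (E `` {v})"
  using min_deg[of v] by simp

text \<open>If two neighbours of \<open>s\<close> had degree at least 4, deleting \<open>s\<close>
  could push the degree below 3 only at the third neighbour \<open>r\<close>, one exceptional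
  vertex.\<close>

lemma cubic_two_cubic_nbrs:
  assumes "cubic s" "(s, p) \<in> E" "(s, q) \<in> E" "p \<noteq> q" "\<not> cubic p"
  shows "cubic q"
proof (rule ccontr)
  assume "\<not> cubic q"
  obtain r where r: "E `` {s} = {p, q, r}" "r \<noteq> p" "r \<noteq> q"
    using card_3_third[OF assms(1), of p q] assms by auto
  note s_iff = nbrs_iff[OF r(1)]
  have "p \<noteq> s" using assms(2) E_irrefl by auto
  have "thick (V - {s}) (vertex_del s E)"
  proof (rule thick_two_exceptions[of _ _ r r p])
    fix y assume y: "y \<in> V - {s}" "y \<notin> {r, r}"
    show "3 \<le> card (vertex_del s E `` {y})"
    proof (cases "y \<in> {p, q}")
      case True
      then have "4 \<le> card (E `` {y})" using assms(5) \<open>\<not> cubic q\<close> y by (intro ge_4) auto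
      moreover have "E `` {y} - {s} \<subseteq> vertex_del s E `` {y}" using y by auto
      then have "card (E `` {y}) \<le> card (vertex_del s E `` {y}) + card {s}"
        using simple_graph.fin_nbrs[OF simple_graph_del] by (intro card_loss) auto
      ultimately show ?thesis by simp
    next
      case False
      then have "(y, s) \<notin> E" using y by (simp add: s_iff)
      then have "vertex_del s E `` {y} = E `` {y}" using y by auto
      then show ?thesis using min_deg y by simp
    qed
  qed (use simple_graph_del in_V[OF assms(2)] \<open>p \<noteq> s\<close> r in auto)
  then show False using not_thick_del assms(1) by blast
qed

text \<open>Deleting \<open>s\<close> and eliminating \<open>b\<close> joins \<open>a\<close> and
  \<open>c\<close> and affects no other vertex. Any further vertex would thus leave a graph that is
  thick, with the edge \<open>ac\<close> as the exception.\<close>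

lemma cubic_twins:
  assumes "cubic s" "cubic b" "E `` {s} = {b, a, c}" "E `` {b} = {s, a, c}" "a \<noteq> c"
  shows "V = {s, b, a, c}"
proof (rule ccontr)
  assume "V \<noteq> {s, b, a, c}"
  note s_iff = nbrs_iff[OF assms(3)] and b_iff = nbrs_iff[OF assms(4)]
  have "{s, b, a, c} \<subseteq> V"
    using nbrs_sub[of s] nbrs_sub[of b] assms(3,4) by auto
  then obtain y\<^sub>0 where y\<^sub>0: "y\<^sub>0 \<in> V" "y\<^sub>0 \<notin> {s, b, a, c}" using \<open>V \<noteq> _\<close> by blast
  define E' where "E' = vertex_elim b (vertex_del s E)"
  have sb: "(s, b) \<in> E" using s_iff by simp
  have neq: "b \<noteq> s" "a \<noteq> s" "c \<noteq> s" "a \<noteq> b" "c \<noteq> b"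
    using nbrs_not_self[OF assms(3)] nbrs_not_self[OF assms(4)] by auto
  have "thick (V - {s} - {b}) E'"
  proof (rule thick_two_exceptions[of _ _ a c y\<^sub>0])
    show "a = c \<or> (a, c) \<in> E'"
      using b_iff neq assms(5) by (simp add: E'_def)
    fix y assume y: "y \<in> V - {s} - {b}" "y \<notin> {a, c}"
    then have "(y, s) \<notin> E" "(y, b) \<notin> E" using s_iff b_iff by auto
    then have "E' `` {y} = E `` {y}" using y E_irrefl by (auto simp: E'_def)
    then show "3 \<le> card (E' `` {y})" using min_deg y by simp
  qed (use y\<^sub>0 simple_graph_elim_del in \<open>auto simp: E'_def\<close>)
  then show False using not_thick_elim[OF assms(1,2) sb] by (simp add: E'_def)
qed

section \<open>Triangles through cubic vertices\<close>

text \<open>Extends the rim of a wheel with hub \<open>c\<close> from \<open>s\<close>,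
  \<open>b\<close> to \<open>b'\<close>. If \<open>b'\<close> were not adjacent to \<open>c\<close>,
  then deleting \<open>s\<close> and eliminating \<open>b\<close> would create the edge
  \<open>b'c\<close>. This repairs the degrees of \<open>b'\<close> and \<open>c\<close>, leaving
  only the third neighbour \<open>a\<close> of \<open>s\<close> as exception.\<close>

lemma fan_step:
  assumes "cubic s" "cubic b" "(s, b) \<in> E" "(s, c) \<in> E" "\<not> cubic c"
    and "E `` {b} = {s, c, b'}" "b' \<noteq> s" "b' \<noteq> c"
  shows "(b', c) \<in> E" "cubic b'"
proof -
  note b_iff = nbrs_iff[OF assms(6)]
  have neq: "s \<noteq> b" "s \<noteq> c" "b \<noteq> c" "b' \<noteq> b"
    using assms(3,4) nbrs_not_self[OF assms(6)] E_irrefl by auto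
  have V: "s \<in> V" "b \<in> V" "c \<in> V" "b' \<in> V"
    using assms(6) nbrs_sub[of b] cubic_in_V[OF assms(2)] by auto
  obtain a where a: "E `` {s} = {b, c, a}" "a \<noteq> b" "a \<noteq> c"
    using card_3_third[OF assms(1), of b c] assms(3,4) neq by auto
  note s_iff = nbrs_iff[OF a(1)]
  have "a \<noteq> s" using nbrs_not_self[OF a(1)] by auto
  have c4: "4 \<le> card (E `` {c})" using ge_4 V assms(5) by blast
  \<comment> \<open>Otherwise \<open>s\<close> and \<open>b\<close> are twins, the graph has only
    four vertices, and \<open>c\<close> cannot have degree 4.\<close>
  have "a \<noteq> b'"
  proof
    assume "a = b'"
    then have V_eq: "V = {s, b, a, c}"
      using a(1) assms(6) a(3) by (intro cubic_twins[OF assms(1,2)]) auto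
    have "E `` {c} \<subseteq> {s, b, a}" using nbrs_sub[of c] E_irrefl unfolding V_eq by auto
    then have "card (E `` {c}) \<le> card {s, b, a}" by (intro card_mono) auto
    also have "\<dots> \<le> 3" by (simp add: card_insert_if)
    finally show False using c4 by simp
  qed
  show "(b', c) \<in> E"
  proof (rule ccontr)
    assume nadj: "(b', c) \<notin> E"
    define E' where "E' = vertex_elim b (vertex_del s E)"
    have fin: "finite (E' `` {y})" for y
      unfolding E'_def by (rule simple_graph.fin_nbrs[OF simple_graph_elim_del])
    have "thick (V - {s} - {b}) E'"
    proof (rule thick_two_exceptions[of _ _ a a c])
      fix y assume y: "y \<in> V - {s} - {b}" "y \<notin> {a, a}"
      consider "y = c" | "y = b'" | "y \<noteq> c" "y \<noteq> b'" by blast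
      then show "3 \<le> card (E' `` {y})"
      proof cases
        case 1
        \<comment> \<open>The hub loses two neighbours and gains one, so its degree 4 drops to no
          less than 3.\<close>
        have "E `` {c} - {s, b} \<union> {b'} \<subseteq> E' `` {c}"
          using assms(7,8) neq b_iff E_irrefl by (auto simp: E'_def)
        then have "card (E `` {c}) + card {b'} \<le> card (E' `` {c}) + card {s, b}"
          using nadj E_sym by (intro card_exchange fin) auto
        then show ?thesis using c4 neq 1 by simp
      next
        case 2
        then have "(y, s) \<notin> E" using s_iff \<open>a \<noteq> b'\<close> neq assms(8) by auto
        then have "E `` {b'} - {b} \<union> {c} \<subseteq> E' `` {b'}"
          using assms(7,8) neq b_iff E_irrefl 2 by (auto simp: E'_def)
        then have "card (E `` {b'}) + card {c} \<le> card (E' `` {b'}) + card {b}"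
          using nadj by (intro card_exchange fin) auto
        then show ?thesis using min_deg V 2 by force
      next
        case 3
        then have "(y, s) \<notin> E" "(y, b) \<notin> E" using s_iff b_iff y by auto
        then have "E' `` {y} = E `` {y}" using y E_irrefl by (auto simp: E'_def)
        then show ?thesis using min_deg y by simp
      qed
    qed (use V neq a simple_graph_elim_del in \<open>auto simp: E'_def\<close>)
    then show False using not_thick_elim[OF assms(1-3)] by (simp add: E'_def)
  qed
  show "cubic b'"
    using b_iff assms(2,5,8) by (intro cubic_two_cubic_nbrs[of b c b']) auto
qed

text \<open>Two vertices of the triangle with the same outer neighbour would be twins, which forces
  four vertices in all.\<close>

lemma triangle_partner:
  assumes "cubic s" "cubic b" "cubic c" "(s, b) \<in> E" "(s, c) \<in> E" "(b, c) \<in> E" "card V \<noteq> 4"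
  obtains a b' c' where "E `` {s} = {b, c, a}" "E `` {b} = {s, c, b'}" "E `` {c} = {s, b, c'}"
    "distinct [s, b, c, a, b', c']"
proof -
  have neq: "s \<noteq> b" "s \<noteq> c" "b \<noteq> c" using assms(4-6) E_irrefl by auto
  have adj: "(b, s) \<in> E" "(c, s) \<in> E" "(c, b) \<in> E" using assms(4-6) E_sym by blast+
  obtain a where a: "E `` {s} = {b, c, a}" "a \<noteq> b" "a \<noteq> c"
    using card_3_third[OF assms(1), of b c] assms(4,5) neq by auto
  obtain b' where b': "E `` {b} = {s, c, b'}" "b' \<noteq> s" "b' \<noteq> c"
    using card_3_third[OF assms(2), of s c] assms(6) adj neq by auto
  obtain c' where c': "E `` {c} = {s, b, c'}" "c' \<noteq> s" "c' \<noteq> b"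
    using card_3_third[OF assms(3), of s b] adj neq by auto
  have self: "a \<noteq> s" "b' \<noteq> b" "c' \<noteq> c"
    using nbrs_not_self[OF a(1)] nbrs_not_self[OF b'(1)] nbrs_not_self[OF c'(1)] by auto
  have "a \<noteq> b'"
  proof
    assume "a = b'"
    then have "V = {s, b, a, c}"
      using a b' by (intro cubic_twins[OF assms(1,2)]) auto
    then show False using assms(7) neq a self by simp
  qed
  moreover have "a \<noteq> c'"
  proof
    assume "a = c'"
    then have "V = {s, c, a, b}"
      using a c' by (intro cubic_twins[OF assms(1,3)]) auto
    then show False using assms(7) neq a self by simp
  qed
  moreover have "b' \<noteq> c'"
  proof
    assume "b' = c'"
    then have "V = {b, c, b', s}"
      using b' c' by (intro cubic_twins[OF assms(2,3)]) auto
    then show False using assms(7) neq b' self by simp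
  qed
  ultimately show thesis using that a b' c' neq self by auto
qed

text \<open>Deleting \<open>s\<close> and eliminating \<open>b\<close>, then \<open>c\<close>,
  replaces the path \<open>b' b c c'\<close> by the edge \<open>b'c'\<close>. If \<open>a\<close> is
  not cubic, it still has degree 3 and the edge \<open>b'c'\<close> is the exception. If
  \<open>b'c'\<close> is a new edge, \<open>b'\<close> and \<open>c'\<close> keep their degrees and
  \<open>a\<close> is the only exception.\<close>

lemma prism_step:
  assumes "cubic s" "cubic b" "cubic c"
    and "E `` {s} = {b, c, a}" "E `` {b} = {s, c, b'}" "E `` {c} = {s, b, c'}"
    and "distinct [s, b, c, a, b', c']"
  shows "cubic a" "(b', c') \<in> E"
proof -
  note iffs = nbrs_iff[OF assms(4)] nbrs_iff[OF assms(5)] nbrs_iff[OF assms(6)]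
  have sb: "(s, b) \<in> E" using iffs by simp
  have V: "a \<in> V" "b' \<in> V" "c' \<in> V" "c \<in> V"
    using assms(4-6) nbrs_sub[of s] nbrs_sub[of b] nbrs_sub[of c] by auto
  define E\<^sub>1 where "E\<^sub>1 = vertex_elim b (vertex_del s E)"
  define E' where "E' = vertex_elim c E\<^sub>1"
  have G': "simple_graph (V - {s} - {b} - {c}) E'"
    unfolding E'_def E\<^sub>1_def
    by (rule simple_graph.simple_graph_elim[OF simple_graph_elim_del])
  note fin = simple_graph.fin_nbrs[OF G']
  have not_thick: "\<not> thick (V - {s} - {b} - {c}) E'"
  proof
    assume thick: "thick (V - {s} - {b} - {c}) E'"
    \<comment> \<open>Of the neighbours \<open>s\<close>, \<open>b\<close>, \<open>c'\<close> of
      \<open>c\<close>, the first is deleted and the second is replaced by \<open>b'\<close>; so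
      \<open>c\<close> can be eliminated next.\<close>
    have "E\<^sub>1 `` {c} \<subseteq> {b', c'}" using assms(7) iffs by (auto simp: E\<^sub>1_def)
    then have "card (E\<^sub>1 `` {c}) \<le> card {b', c'}" by (intro card_mono) auto
    then have "card (E\<^sub>1 `` {c}) \<le> 2" using assms(7) by simp
    moreover have "c \<in> V - {s} - {b}" using V assms(7) by auto
    ultimately have "thick (V - {s} - {b}) E\<^sub>1"
      using thick thick.elim unfolding E'_def by metis
    then show False using not_thick_elim[OF assms(1,2) sb] by (simp add: E\<^sub>1_def)
  qed
  have new: "(b', c') \<in> E'" "(c', b') \<in> E'" using assms(7) iffs by (auto simp: E'_def E\<^sub>1_def)
  have old: "E' `` {y} = E `` {y}" if "y \<in> V" "y \<notin> {s, b, c, a, b', c'}" for y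
    using that iffs E_irrefl by (auto simp: E'_def E\<^sub>1_def)
  show "cubic a"
  proof (rule ccontr)
    assume "\<not> cubic a"
    have "thick (V - {s} - {b} - {c}) E'"
    proof (rule thick_two_exceptions[of _ _ b' c' a, OF G'])
      fix y assume y: "y \<in> V - {s} - {b} - {c}" "y \<notin> {b', c'}"
      show "3 \<le> card (E' `` {y})"
      proof (cases "y = a")
        case True
        have "E `` {a} - {s} \<subseteq> E' `` {a}"
          using assms(7) iffs E_irrefl by (auto simp: E'_def E\<^sub>1_def)
        then have "card (E `` {a}) \<le> card (E' `` {a}) + card {s}"
          by (intro card_loss fin) auto
        then show ?thesis using True ge_4[OF V(1) \<open>\<not> cubic a\<close>] by simp
      next
        case False
        then show ?thesis using old y min_deg by simp
      qed
    qed (use V new assms(7) in auto)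
    then show False using not_thick by blast
  qed
  show "(b', c') \<in> E"
  proof (rule ccontr)
    assume nadj: "(b', c') \<notin> E"
    have "thick (V - {s} - {b} - {c}) E'"
    proof (rule thick_two_exceptions[of _ _ a a b', OF G'])
      fix y assume y: "y \<in> V - {s} - {b} - {c}" "y \<notin> {a, a}"
      consider "y = b'" | "y = c'" | "y \<noteq> b'" "y \<noteq> c'" by blast
      then show "3 \<le> card (E' `` {y})"
      proof cases
        case 1
        have "E `` {b'} - {b} \<union> {c'} \<subseteq> E' `` {b'}"
          using assms(7) iffs E_irrefl new by (auto simp: E'_def E\<^sub>1_def)
        then have "card (E `` {b'}) + card {c'} \<le> card (E' `` {b'}) + card {b}"
          using nadj by (intro card_exchange fin) auto
        then show ?thesis using 1 min_deg[OF V(2)] by simp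
      next
        case 2
        have "E `` {c'} - {c} \<union> {b'} \<subseteq> E' `` {c'}"
          using assms(7) iffs E_irrefl new by (auto simp: E'_def E\<^sub>1_def)
        then have "card (E `` {c'}) + card {b'} \<le> card (E' `` {c'}) + card {c}"
          using nadj E_sym by (intro card_exchange fin) auto
        then show ?thesis using 2 min_deg[OF V(3)] by simp
      next
        case 3
        then show ?thesis using old y min_deg by simp
      qed
    qed (use V assms(7) in auto)
    then show False using not_thick by blast
  qed
qed

end

section \<open>No cubic vertex in a triangle\<close>

locale cubic_triangle_free_graph = critical_graph +
  assumes triangle_free: "card (E `` {u}) = 3 \<Longrightarrow> (u, v) \<in> E \<Longrightarrow> (u, w) \<in> E \<Longrightarrow> (v, w) \<notin> E"
begin

text \<open>Here \<open>a\<close> is deleted and \<open>s\<close> eliminated. The other neighbours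
  \<open>b\<close>, \<open>c\<close> of \<open>s\<close> are nonadjacent, so each trades
  \<open>s\<close> for the other. A vertex \<open>a\<^sub>1\<close> of degree at least 4 can afford
  to lose \<open>a\<close>, which leaves \<open>a\<^sub>2\<close> as the only exception.\<close>

lemma cubic_spreads:
  assumes "cubic s" "cubic a" "(s, a) \<in> E" "(a, a\<^sub>1) \<in> E"
  shows "cubic a\<^sub>1"
proof (rule ccontr)
  assume "\<not> cubic a\<^sub>1"
  then have "a\<^sub>1 \<noteq> s" using assms(1) by blast
  have as: "(a, s) \<in> E" using assms(3) E_sym by blast
  obtain a\<^sub>2 where a: "E `` {a} = {s, a\<^sub>1, a\<^sub>2}" "a\<^sub>2 \<noteq> s" "a\<^sub>2 \<noteq> a\<^sub>1"
    using card_3_third[OF assms(2), of s a\<^sub>1] assms(4) as \<open>a\<^sub>1 \<noteq> s\<close> by auto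
  obtain b c where s: "E `` {s} = {a, b, c}" "b \<noteq> a" "c \<noteq> a" "c \<noteq> b"
    using card_3_rest[OF assms(1), of a] assms(3) by auto
  note iffs = nbrs_iff[OF a(1)] nbrs_iff[OF s(1)]
  have neq: "a \<noteq> s" "b \<noteq> s" "c \<noteq> s" "a\<^sub>1 \<noteq> a" "a\<^sub>2 \<noteq> a"
    using nbrs_not_self[OF a(1)] nbrs_not_self[OF s(1)] by auto
  have nadj: "(b, c) \<notin> E" "(c, b) \<notin> E" using triangle_free[OF assms(1)] iffs by auto
  have dj: "b \<notin> {a\<^sub>1, a\<^sub>2}" "c \<notin> {a\<^sub>1, a\<^sub>2}"
    using triangle_free[OF assms(1,3)] iffs by auto
  have V: "a\<^sub>1 \<in> V" "b \<in> V" "c \<in> V"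
    using a(1) s(1) nbrs_sub[of a] nbrs_sub[of s] by auto
  define E' where "E' = vertex_elim s (vertex_del a E)"
  have G': "simple_graph (V - {a} - {s}) E'"
    unfolding E'_def by (rule simple_graph_elim_del)
  note fin = simple_graph.fin_nbrs[OF G']
  have "thick (V - {a} - {s}) E'"
  proof (rule thick_two_exceptions[of _ _ a\<^sub>2 a\<^sub>2 b, OF G'])
    fix y assume y: "y \<in> V - {a} - {s}" "y \<notin> {a\<^sub>2, a\<^sub>2}"
    consider "y = a\<^sub>1" | "y = b" | "y = c" | "y \<notin> {a\<^sub>1, b, c}" by blast
    then show "3 \<le> card (E' `` {y})"
    proof cases
      case 1
      have "E `` {a\<^sub>1} - {a} \<subseteq> E' `` {a\<^sub>1}"
        using neq dj \<open>a\<^sub>1 \<noteq> s\<close> iffs E_irrefl by (auto simp: E'_def)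
      then have "card (E `` {a\<^sub>1}) \<le> card (E' `` {a\<^sub>1}) + card {a}"
        by (intro card_loss fin) auto
      then show ?thesis using 1 ge_4[OF V(1) \<open>\<not> cubic a\<^sub>1\<close>] by simp
    next
      case 2
      have "E `` {b} - {s} \<union> {c} \<subseteq> E' `` {b}"
        unfolding E'_def using neq dj s(2-4) iffs by (intro elim_del_nbrs) auto
      then have "card (E `` {b}) + card {c} \<le> card (E' `` {b}) + card {s}"
        using nadj by (intro card_exchange fin) auto
      then show ?thesis using 2 min_deg[OF V(2)] by simp
    next
      case 3
      have "E `` {c} - {s} \<union> {b} \<subseteq> E' `` {c}"
        unfolding E'_def using neq dj s(2-4) iffs by (intro elim_del_nbrs) auto
      then have "card (E `` {c}) + card {b} \<le> card (E' `` {c}) + card {s}"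
        using nadj by (intro card_exchange fin) auto
      then show ?thesis using 3 min_deg[OF V(3)] by simp
    next
      case 4
      then have "E' `` {y} = E `` {y}" using y iffs E_irrefl by (auto simp: E'_def)
      then show ?thesis using y min_deg by simp
    qed
  qed (use V neq dj s(2-4) in auto)
  then show False using not_thick_elim[OF assms(2,1) as] by (simp add: E'_def)
qed

lemma all_cubic: "v \<in> V \<Longrightarrow> cubic v"
proof -
  obtain s where s: "s \<in> V" "cubic s" using ex_cubic by blast
  then obtain a b c where abc: "E `` {s} = {a, b, c}" "a \<noteq> b" by (auto simp: card_3_iff)
  \<comment> \<open>Spreading starts from an edge with two cubic ends, so the set to be shown closed
    consists of the cubic vertices with a cubic neighbour. One of \<open>a\<close>, \<open>b\<close>
    is cubic and provides a member.\<close>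
  have "{v. cubic v \<and> (\<exists>u. cubic u \<and> (u, v) \<in> E)} = V"
  proof (rule closed_eq_V)
    show "{v. cubic v \<and> (\<exists>u. cubic u \<and> (u, v) \<in> E)} \<subseteq> V" using cubic_in_V by blast
    have "cubic a \<or> cubic b" using cubic_two_cubic_nbrs[OF s(2), of a b] abc by auto
    then show "{v. cubic v \<and> (\<exists>u. cubic u \<and> (u, v) \<in> E)} \<noteq> {}"
      using s(2) abc(1) by blast
    show "E `` {v} \<subseteq> {v. cubic v \<and> (\<exists>u. cubic u \<and> (u, v) \<in> E)}"
      if "v \<in> {v. cubic v \<and> (\<exists>u. cubic u \<and> (u, v) \<in> E)}" for v
      using that cubic_spreads by blast
  qed
  then show "v \<in> V \<Longrightarrow> cubic v" by blast
qed

text \<open>Delete \<open>s\<close> and eliminate \<open>a\<close> and \<open>b\<close>, each of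
  which then has two neighbours. A vertex adjacent to \<open>a\<close> or \<open>b\<close> gains the
  opposite neighbour in exchange, and this is a new one by triangle-freeness. Unless
  \<open>a\<close> and \<open>b\<close> have equal neighbourhoods, only \<open>c\<close> can drop
  below degree 3.\<close>

lemma nbrs_eq_if_common_nbr:
  assumes s: "E `` {s} = {a, b, c}" "distinct [a, b, c]"
  shows "E `` {b} = E `` {a}"
proof (rule ccontr)
  assume neq: "E `` {b} \<noteq> E `` {a}"
  note s_iff = nbrs_iff[OF s(1)]
  have sabc: "(s, a) \<in> E" "(s, b) \<in> E" "(s, c) \<in> E" "(a, s) \<in> E" "(b, s) \<in> E" using s_iff by auto
  have V: "s \<in> V" "a \<in> V" "b \<in> V" "c \<in> V" using sabc in_V by blast+
  note tf = triangle_free[OF all_cubic]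
  have nadj: "(a, b) \<notin> E" "(a, c) \<notin> E" "(b, a) \<notin> E" "(b, c) \<notin> E" using tf[OF V(1)] sabc by blast+
  have s_neq: "s \<noteq> a" "s \<noteq> b" "s \<noteq> c" using nbrs_not_self[OF s(1)] by auto
  define E\<^sub>1 where "E\<^sub>1 = vertex_elim a (vertex_del s E)"
  define E' where "E' = vertex_elim b E\<^sub>1"
  have G': "simple_graph (V - {s} - {a} - {b}) E'"
    unfolding E'_def E\<^sub>1_def
    by (rule simple_graph.simple_graph_elim[OF simple_graph_elim_del])
  note fin = simple_graph.fin_nbrs[OF G']
  have not_thick: "\<not> thick (V - {s} - {a} - {b}) E'"
  proof
    assume thick: "thick (V - {s} - {a} - {b}) E'"
    have "E\<^sub>1 `` {b} \<subseteq> E `` {b} - {s}" using nadj by (auto simp: E\<^sub>1_def)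
    then have "card (E\<^sub>1 `` {b}) \<le> card (E `` {b} - {s})" by (intro card_mono) auto
    then have "card (E\<^sub>1 `` {b}) \<le> 2" using all_cubic[OF V(3)] sabc by simp
    moreover have "b \<in> V - {s} - {a}" using V s_neq s(2) by auto
    ultimately have "thick (V - {s} - {a}) E\<^sub>1"
      using thick thick.elim unfolding E'_def by metis
    then show False
      using not_thick_elim[OF all_cubic all_cubic sabc(1)] V by (simp add: E\<^sub>1_def)
  qed
  have other: "\<exists>z. E `` {v} = {s, y, z} \<and> z \<noteq> y \<and> z \<noteq> s \<and> (y, z) \<notin> E"
    if yv: "(y, v) \<in> E" "y \<noteq> s" "v \<in> {a, b}" for v y
  proof -
    have v: "v \<in> V" "(v, s) \<in> E" "(v, y) \<in> E" using yv V sabc E_sym by auto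
    then obtain z where z: "E `` {v} = {s, y, z}" "z \<noteq> s" "z \<noteq> y"
      using card_3_third[OF all_cubic[OF v(1)], of s y] yv(2) by auto
    then have "(y, z) \<notin> E" using tf[OF v(1,3), of z] by auto
    then show ?thesis using z by blast
  qed
  \<comment> \<open>The vertex \<open>a\<^sub>1\<close> only witnesses that something besides the
    exception \<open>c\<close> is left.\<close>
  obtain a\<^sub>1 a\<^sub>2 where a12: "E `` {a} = {s, a\<^sub>1, a\<^sub>2}" "a\<^sub>1 \<noteq> s"
    using card_3_rest[OF all_cubic[OF V(2)], of s] sabc by blast
  then have a1: "(a, a\<^sub>1) \<in> E" by auto
  then have "a\<^sub>1 \<in> V - {s} - {a} - {b}" "a\<^sub>1 \<notin> {c, c}"
    using in_V nadj E_irrefl a12(2) by auto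
  then have "thick (V - {s} - {a} - {b}) E'"
  proof (rule thick_two_exceptions[OF G' disjI1[OF refl]])
    fix y assume y: "y \<in> V - {s} - {a} - {b}" "y \<notin> {c, c}"
    then have ys: "(y, s) \<notin> E" "y \<in> V" "y \<noteq> s" "y \<noteq> a" "y \<noteq> b" using s_iff by auto
    have keep: "E `` {y} - {a, b} \<subseteq> E' `` {y}"
      using ys E_irrefl by (auto simp: E'_def E\<^sub>1_def)
    have new_a: "(y, z) \<in> E'" if "E `` {a} = {s, y, z}" "z \<noteq> y" "z \<noteq> s" for z
    proof -
      have "(a, z) \<in> E" "(y, a) \<in> E" using nbrs_iff[OF that(1)] by auto
      then show ?thesis using that(2,3) ys nadj E_irrefl by (auto simp: E'_def E\<^sub>1_def)
    qed
    have new_b: "(y, z) \<in> E'" if "E `` {b} = {s, y, z}" "z \<noteq> y" "z \<noteq> s" for z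
    proof -
      have "(b, z) \<in> E" "(y, b) \<in> E" using nbrs_iff[OF that(1)] by auto
      then show ?thesis using that(2,3) ys nadj E_irrefl s_neq s(2) by (auto simp: E'_def E\<^sub>1_def)
    qed
    show "3 \<le> card (E' `` {y})"
    proof (cases "(y, a) \<in> E")
      case True
      obtain z where z: "E `` {a} = {s, y, z}" "z \<noteq> y" "z \<noteq> s" "(y, z) \<notin> E"
        using other[OF True] ys by blast
      show ?thesis
      proof (cases "(y, b) \<in> E")
        case yb: True
        obtain w where w: "E `` {b} = {s, y, w}" "w \<noteq> y" "w \<noteq> s" "(y, w) \<notin> E"
          using other[OF yb] ys by blast
        \<comment> \<open>The one place where the neighbourhoods of \<open>a\<close> and
          \<open>b\<close> must differ: a vertex losing both \<open>a\<close> and \<open>b\<close>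
          needs two distinct replacements.\<close>
        have "z \<noteq> w" using neq z(1) w(1) by auto
        have "card (E `` {y}) + card {z, w} \<le> card (E' `` {y}) + card {a, b}"
          using keep new_a[OF z(1-3)] new_b[OF w(1-3)] z(4) w(4)
          by (intro card_exchange fin) auto
        then show ?thesis using all_cubic[OF ys(2)] \<open>z \<noteq> w\<close> s(2) by simp
      next
        case yb: False
        then have "card (E `` {y}) + card {z} \<le> card (E' `` {y}) + card {a}"
          using keep new_a[OF z(1-3)] z(4)
          by (intro card_exchange fin) auto
        then show ?thesis using all_cubic[OF ys(2)] by simp
      qed
    next
      case ya: False
      show ?thesis
      proof (cases "(y, b) \<in> E")
        case yb: True
        obtain w where w: "E `` {b} = {s, y, w}" "w \<noteq> y" "w \<noteq> s" "(y, w) \<notin> E"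
          using other[OF yb] ys by blast
        have "card (E `` {y}) + card {w} \<le> card (E' `` {y}) + card {b}"
          using keep ya new_b[OF w(1-3)] w(4)
          by (intro card_exchange fin) auto
        then show ?thesis using all_cubic[OF ys(2)] by simp
      next
        case False
        then have "E `` {y} \<subseteq> E' `` {y}" using keep ya by auto
        then have "card (E `` {y}) \<le> card (E' `` {y})" by (intro card_mono fin)
        then show ?thesis using all_cubic[OF ys(2)] by simp
      qed
    qed
  qed
  then show False using not_thick by blast
qed

text \<open>The three neighbours of \<open>s\<close> share one neighbourhood
  \<open>{s, p, q}\<close>. Its members are cubic, so each has exactly \<open>a\<close>,
  \<open>b\<close>, \<open>c\<close> as neighbours; these six vertices form a closed set.\<close>

lemma complete_bipartite:
  "complete_bipartite_digraph 3 3 (with_proj \<lparr>pverts = V, parcs = E\<rparr>)"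
proof -
  obtain s where s: "s \<in> V" "cubic s" using ex_cubic by blast
  then obtain a b c where abc: "E `` {s} = {a, b, c}" "a \<noteq> b" "a \<noteq> c" "b \<noteq> c"
    by (auto simp: card_3_iff)
  have nb: "E `` {b} = E `` {a}"
    using nbrs_eq_if_common_nbr[OF abc(1)] abc by auto
  have nc: "E `` {c} = E `` {a}"
    using nbrs_eq_if_common_nbr[of s a c b] abc
    by (auto simp: insert_commute)
  have sa: "(a, s) \<in> E" "a \<in> V" using nbrs_iff[OF abc(1)] nbrs_sub[of s] abc(1) by auto
  obtain p q where pq: "E `` {a} = {s, p, q}" "p \<noteq> s" "q \<noteq> s" "q \<noteq> p"
    using card_3_rest[OF all_cubic[OF sa(2)], of s] sa by auto
  have adj: "(p, a) \<in> E" "(p, b) \<in> E" "(p, c) \<in> E" "(q, a) \<in> E" "(q, b) \<in> E" "(q, c) \<in> E"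
    using nbrs_iff(2)[OF pq(1)] nbrs_iff(2)[OF nb[unfolded pq(1)]] nbrs_iff(2)[OF nc[unfolded pq(1)]]
    by simp_all
  have np: "E `` {p} = {a, b, c}" and nq: "E `` {q} = {a, b, c}"
    using adj all_cubic in_V abc by (intro card_3_eqI; simp; blast)+
  define U W where "U = {s, p, q}" and "W = {a, b, c}"
  have U: "E `` {u} = W" if "u \<in> U" for u
    using that abc(1) np nq by (auto simp: U_def W_def)
  have W: "E `` {w} = U" if "w \<in> W" for w
    using that pq(1) nb nc by (auto simp: U_def W_def)
  have "U \<inter> W = {}"
  proof (rule ccontr)
    assume "U \<inter> W \<noteq> {}"
    then obtain x where "x \<in> U" "x \<in> W" by blast
    then have "x \<in> E `` {x}" using U by blast
    then show False using E_irrefl by blast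
  qed
  moreover have "U \<union> W = V"
  proof (rule closed_eq_V)
    show "U \<union> W \<subseteq> V" using adj in_V s(1) by (auto simp: U_def W_def)
    show "U \<union> W \<noteq> {}" by (simp add: U_def)
    show "E `` {y} \<subseteq> U \<union> W" if "y \<in> U \<union> W" for y using that U W by blast
  qed
  moreover have "E = U \<times> W \<union> W \<times> U"
  proof (rule subset_antisym; rule subrelI)
    fix x y assume xy: "(x, y) \<in> E"
    then have "x \<in> U \<or> x \<in> W" using in_V \<open>U \<union> W = V\<close> by blast
    then show "(x, y) \<in> U \<times> W \<union> W \<times> U" using U[of x] W[of x] xy by auto
  next
    fix x y assume "(x, y) \<in> U \<times> W \<union> W \<times> U"
    then show "(x, y) \<in> E" using U[of x] W[of x] by auto
  qed
  moreover have "card U = 3" "card W = 3" using pq abc by (auto simp: U_def W_def)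
  ultimately show ?thesis
    unfolding complete_bipartite_digraph_pair_def using finV
    by (intro conjI exI[of _ U] exI[of _ W]) simp_all
qed

end

section \<open>Connected 2-regular graphs are cycles\<close>

text \<open>Follow a walk that never turns back until it first repeats a vertex. The repeated vertex
  is the starting one, and the vertices visited form a closed set; connectedness, in the form of
  \<open>conn\<close>, makes them all of \<open>X\<close>.\<close>

lemma two_regular_cycle:
  fixes F :: "'a rel"
  assumes "finite X" "X \<noteq> {}" "F \<subseteq> X \<times> X" "\<And>x y. (x, y) \<in> F \<Longrightarrow> (y, x) \<in> F"
    and irrefl: "\<And>x. (x, x) \<notin> F"
    and reg: "\<And>x. x \<in> X \<Longrightarrow> card (F `` {x}) = 2"
    and conn: "\<And>Z. Z \<subseteq> X \<Longrightarrow> Z \<noteq> {} \<Longrightarrow> (\<And>z. z \<in> Z \<Longrightarrow> F `` {z} \<subseteq> Z) \<Longrightarrow> Z = X"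
  obtains l c where "3 \<le> l" "inj_on c {..<l}" "X = c ` {..<l}"
    "F = (\<Union>i<l. {(c i, c (Suc i mod l)), (c (Suc i mod l), c i)})"
proof -
  obtain x\<^sub>0 where "x\<^sub>0 \<in> X" using assms(2) by blast
  then have "F `` {x\<^sub>0} \<noteq> {}" using reg[of x\<^sub>0] by auto
  then obtain x\<^sub>1 where "(x\<^sub>0, x\<^sub>1) \<in> F" by blast
  have next_ex: "\<exists>r. F `` {q} = {p, r} \<and> r \<noteq> p" if "(p, q) \<in> F" for p q
  proof -
    have "p \<in> F `` {q}" "card (F `` {q}) = 2" using that assms(3,4) reg by auto
    then obtain x y where "F `` {q} = {x, y}" "x \<noteq> y" "p = x \<or> p = y"
      by (auto simp: card_2_iff)
    then show ?thesis by (metis insert_commute)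
  qed
  \<comment> \<open>The walk is chosen as a sequence of arcs, since the next vertex depends on the
    previous two.\<close>
  have "\<exists>g. \<forall>n. g n \<in> F \<and> (fst (g (Suc n)) = snd (g n) \<and>
      F `` {snd (g n)} = {fst (g n), snd (g (Suc n))} \<and> snd (g (Suc n)) \<noteq> fst (g n))"
  proof (rule dependent_nat_choice)
    show "\<exists>e. e \<in> F" using \<open>(x\<^sub>0, x\<^sub>1) \<in> F\<close> by blast
    fix e and n :: nat assume "e \<in> F"
    then obtain p q where e: "e = (p, q)" "(p, q) \<in> F" by (cases e) auto
    obtain r where r: "F `` {q} = {p, r}" "r \<noteq> p" using next_ex[OF e(2)] by blast
    then have "(q, r) \<in> F" by auto
    then show "\<exists>e'. e' \<in> F \<and> (fst e' = snd e \<and> F `` {snd e} = {fst e, snd e'} \<and> snd e' \<noteq> fst e)"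
      using e r by (intro exI[of _ "(q, r)"]) simp
  qed
  then obtain g where g: "\<And>n. g n \<in> F" "\<And>n. fst (g (Suc n)) = snd (g n)"
    "\<And>n. F `` {snd (g n)} = {fst (g n), snd (g (Suc n))}" "\<And>n. snd (g (Suc n)) \<noteq> fst (g n)"
    by blast
  define f where "f n = fst (g n)" for n
  have step: "(f n, f (Suc n)) \<in> F" for n
    using g(1,2)[of n] by (metis f_def prod.collapse)
  have nbrs: "F `` {f (Suc n)} = {f n, f (Suc (Suc n))}" and no_back: "f (Suc (Suc n)) \<noteq> f n" for n
    using g(2-4)[of n] g(2)[of "Suc n"] by (auto simp: f_def)
  have f_X: "f n \<in> X" for n using step[of n] assms(3) by auto
  have f_Suc: "f (Suc n) \<noteq> f n" for n using step[of n] irrefl by metis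
  have "\<not> inj f"
    using f_X assms(1) by (metis finite_subset image_subsetI infinite_UNIV_nat finite_imageD)
  then obtain i' j' where "i' < j'" "f i' = f j'" by (metis injI linorder_neqE_nat)
  then have ex: "\<exists>j. f j \<in> f ` {..<j}" by (metis imageI lessThan_iff)
  define l where "l = (LEAST j. f j \<in> f ` {..<j})"
  have l: "f l \<in> f ` {..<l}" unfolding l_def using ex by (rule LeastI_ex)
  have least: "f j \<notin> f ` {..<j}" if "j < l" for j
    using that unfolding l_def by (rule not_less_Least)
  have inj: "inj_on f {..<l}"
  proof (rule inj_onI)
    fix i j assume "i \<in> {..<l}" "j \<in> {..<l}" "f i = f j"
    then show "i = j" using least[of i] least[of j] by (metis imageI lessThan_iff linorder_neqE_nat)
  qed
  obtain i where i: "i < l" "f l = f i" using l by auto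
  obtain m where m: "l = Suc m" using i by (cases l) auto
  \<comment> \<open>An inner vertex \<open>f i\<close> has its two neighbours on the walk already.
    So \<open>f m\<close>, the vertex before the repetition, equals \<open>f k\<close>, against
    injectivity, or \<open>f (Suc i)\<close>, which would make the walk turn back.\<close>
  have "i = 0"
  proof (rule ccontr)
    assume "i \<noteq> 0"
    then obtain k where k: "i = Suc k" by (cases i) auto
    have "f m \<in> F `` {f i}" using step[of m] assms(4) i(2) m by auto
    then have "f m = f k \<or> f m = f (Suc i)" using nbrs[of k] k by auto
    then show False
    proof
      assume "f m = f k"
      then show False using inj_onD[OF inj, of m k] i(1) m k by simp
    next
      assume eq: "f m = f (Suc i)"
      have "Suc i \<noteq> l" using i(2) f_Suc[of i] by auto
      then have "m = Suc i" using inj_onD[OF inj eq] i(1) m by simp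
      then show False using no_back[of i] i(2) m by simp
    qed
  qed
  then have fl: "f l = f 0" using i by simp
  \<comment> \<open>Length 1 would be a loop, and length 2 would be an immediate return.\<close>
  have "l \<noteq> 1" "l \<noteq> 2" using fl f_Suc[of 0] no_back[of 0] by (auto simp: numeral_2_eq_2)
  then have l3: "3 \<le> l" using m by simp
  have nbr_0: "F `` {f 0} = {f 1, f m}"
  proof -
    have "f 1 \<noteq> f m" using inj_onD[OF inj, of 1 m] l3 m by auto
    then have "card {f 1, f m} = 2" by simp
    moreover have "{f 1, f m} \<subseteq> F `` {f 0}"
      using step[of 0] step[of m] assms(4) fl m by auto
    moreover have "finite (F `` {f 0})" using reg[OF f_X] by (metis card.infinite zero_neq_numeral)
    ultimately show ?thesis using reg[OF f_X] by (metis card_subset_eq)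
  qed
  have closed: "F `` {f k} \<subseteq> f ` {..<l}" if "k < l" for k
  proof (cases k)
    case 0
    then show ?thesis using nbr_0 l3 m by auto
  next
    case (Suc n)
    have "f (Suc k) \<in> f ` {..<l}"
      using that fl by (cases "Suc k = l") auto
    then show ?thesis using nbrs[of n] Suc that by auto
  qed
  have X: "f ` {..<l} = X"
  proof (rule conn)
    show "f ` {..<l} \<noteq> {}" using i(1) by auto
    show "F `` {z} \<subseteq> f ` {..<l}" if "z \<in> f ` {..<l}" for z
      using that closed by blast
  qed (use f_X in auto)
  have f_mod: "f (Suc k mod l) = f (Suc k)" if "k < l" for k
    using that fl by (cases "Suc k = l") auto
  have "F = (\<Union>i<l. {(f i, f (Suc i mod l)), (f (Suc i mod l), f i)})" (is "_ = ?R")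
  proof
    show "?R \<subseteq> F" using step assms(4) by (auto simp: f_mod)
    show "F \<subseteq> ?R"
    proof
      fix e assume "e \<in> F"
      then obtain x y where e: "e = (x, y)" "(x, y) \<in> F" by (cases e) auto
      then obtain k where k: "k < l" "x = f k" using assms(3) X by auto
      show "e \<in> ?R"
      proof (cases k)
        case 0
        then have "y = f 1 \<or> y = f m" using nbr_0 e k by auto
        then show ?thesis
        proof
          assume "y = f 1"
          then show ?thesis using e k 0 f_mod[of 0] l3 by (intro UN_I[of 0]) auto
        next
          assume "y = f m"
          then show ?thesis using e k 0 f_mod[of m] m fl by (intro UN_I[of m]) auto
        qed
      next
        case (Suc n)
        then have "y = f n \<or> y = f (Suc k)" using nbrs[of n] e k by auto
        then show ?thesis
        proof
          assume "y = f n"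
          then show ?thesis using e k Suc f_mod[of n] by (intro UN_I[of n]) auto
        next
          assume "y = f (Suc k)"
          then show ?thesis using e k f_mod[of k] by (intro UN_I[of k]) auto
        qed
      qed
    qed
  qed
  then show thesis using that l3 inj X by blast
qed

section \<open>Identifying the reduced graph\<close>

context critical_graph
begin

text \<open>Minimum degree 3 on four vertices forces all edges, and the complete graph on four
  vertices is the wheel with three spokes.\<close>

lemma wheel_if_complete:
  assumes "card V = 4"
  shows "wheel 3 (with_proj \<lparr>pverts = V, parcs = E\<rparr>)"
proof -
  have nbrs: "E `` {v} = V - {v}" if "v \<in> V" for v
  proof (rule card_subset_eq)
    show "E `` {v} \<subseteq> V - {v}" using nbrs_sub E_irrefl by auto
    then have "card (E `` {v}) \<le> card (V - {v})" using finV by (intro card_mono) auto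
    then show "card (E `` {v}) = card (V - {v})" using min_deg[OF that] assms that finV by simp
  qed (use finV in auto)
  obtain h where "h \<in> V" using assms by (metis card.empty ex_in_conv zero_neq_numeral)
  then have "card (V - {h}) = 3" using assms by simp
  then obtain p q r where pqr: "V - {h} = {p, q, r}" "p \<noteq> q" "p \<noteq> r" "q \<noteq> r"
    by (auto simp: card_3_iff)
  then have V: "V = {h, p, q, r}" and hn: "h \<notin> {p, q, r}" using \<open>h \<in> V\<close> by auto
  define c where "c i = [p, q, r] ! i" for i
  have c: "c 0 = p" "c 1 = q" "c (Suc 0) = q" "c 2 = r" by (simp_all add: c_def)
  have lt3: "{..<3::nat} = {0, 1, 2}" by auto
  have diffs: "V - {h} = {p, q, r}" "V - {p} = {h, q, r}" "V - {q} = {h, p, r}" "V - {r} = {h, p, q}"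
    using pqr(2-4) hn V by auto
  have "E = (\<Union>x\<in>V. {x} \<times> (V - {x}))" using E_eq_Union by (simp add: nbrs)
  also have "\<dots> = (\<Union>x\<in>{h, p, q, r}. {x} \<times> (V - {x}))" by (subst V) (rule refl)
  finally have E: "E = {h} \<times> {p, q, r} \<union> ({p} \<times> {h, q, r} \<union> ({q} \<times> {h, p, r} \<union> {r} \<times> {h, p, q}))"
    by (simp only: UN_insert UN_empty Un_empty_right diffs)
  show ?thesis
  proof (rule wheelI)
    show "inj_on c {..<3}" "h \<notin> c ` {..<3}" "V = insert h (c ` {..<3})"
      using pqr hn V by (auto simp: lt3 c)
    have mod3: "c (Suc 0 mod 3) = q" "c (Suc 1 mod 3) = r" "c (Suc 2 mod 3) = p"
      using c by (simp_all add: numeral_2_eq_2[symmetric])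
    show "E = (\<Union>i<3. {(c i, c (Suc i mod 3)), (c (Suc i mod 3), c i), (h, c i), (c i, h)})"
      unfolding lt3 UN_insert UN_empty mod3 c E by blast
  qed simp
qed

text \<open>By \<open>fan_step\<close> the rim vertices \<open>X\<close> have no neighbours outside
  \<open>X\<close> except the hub \<open>h\<close>. Criticality excludes both further vertices and a
  second rim component, so \<open>X\<close> carries a single cycle.\<close>

lemma wheel_if_fan:
  assumes "cubic s" "cubic b" "(s, b) \<in> E" "(s, h) \<in> E" "(b, h) \<in> E" "\<not> cubic h"
  shows "\<exists>l. wheel l (with_proj \<lparr>pverts = V, parcs = E\<rparr>)"
proof -
  \<comment> \<open>The neighbour \<open>u\<close> gives each rim vertex a rim edge from which
    \<open>fan_step\<close> can continue.\<close>
  define X where "X = {v. cubic v \<and> (v, h) \<in> E \<and> (\<exists>u. cubic u \<and> (u, h) \<in> E \<and> (u, v) \<in> E)}"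
  have "s \<in> X" using assms E_sym by (auto simp: X_def)
  have "h \<notin> X" using assms(6) by (auto simp: X_def)
  have X_V: "X \<subseteq> V" using cubic_in_V by (auto simp: X_def)
  have hX: "(x, h) \<in> E" "(h, x) \<in> E" if "x \<in> X" for x using that E_sym by (auto simp: X_def)
  have X_closed: "E `` {v} \<subseteq> insert h X" if vX: "v \<in> X" for v
  proof -
    obtain u where u: "cubic u" "(u, h) \<in> E" "(u, v) \<in> E" and v: "cubic v" "(v, h) \<in> E"
      using vX by (auto simp: X_def)
    have "(v, u) \<in> E" "u \<noteq> h" using u E_sym assms(6) by auto
    then obtain y where y: "E `` {v} = {u, h, y}" "y \<noteq> u" "y \<noteq> h"
      using card_3_third[OF v(1), of u h] v by auto
    have "(y, h) \<in> E" "cubic y" using fan_step[OF u(1) v(1) u(3,2) assms(6) y] by auto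
    moreover have "(v, y) \<in> E" using y(1) by auto
    ultimately have "y \<in> X" "u \<in> X" using u v \<open>(v, u) \<in> E\<close> by (auto simp: X_def)
    then show ?thesis using y(1) by auto
  qed
  \<comment> \<open>The vertices beyond the rim are attached at \<open>h\<close> only and miss the
    cubic vertex \<open>s\<close>.\<close>
  have "V - insert h X = {}"
  proof (rule ccontr)
    assume "V - insert h X \<noteq> {}"
    then show False
    proof (rule attached_meets_cubic[rotated, of _ h s])
      fix y assume y: "y \<in> V - insert h X"
      show "E `` {y} \<subseteq> insert h (V - insert h X)"
        using X_closed E_sym y in_V by blast
      show "(y, s) \<notin> E" using X_closed[OF \<open>s \<in> X\<close>] E_sym y by blast
    qed (use assms(1) \<open>s \<in> X\<close> in auto)
  qed
  then have V: "V = insert h X" using X_V in_V[OF assms(4)] by auto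
  define F where "F = E \<inter> X \<times> X"
  have F_nbrs: "F `` {x} = E `` {x} - {h}" if "x \<in> X" for x
    using X_closed[OF that] that \<open>h \<notin> X\<close> by (auto simp: F_def)
  have E: "E = F \<union> {h} \<times> X \<union> X \<times> {h}"
  proof
    show "E \<subseteq> F \<union> {h} \<times> X \<union> X \<times> {h}"
      using E_sub[unfolded V] E_irrefl unfolding F_def by blast
    show "F \<union> {h} \<times> X \<union> X \<times> {h} \<subseteq> E"
      using hX unfolding F_def by blast
  qed
  obtain l c where lc: "3 \<le> l" "inj_on c {..<l}" "X = c ` {..<l}"
    "F = (\<Union>i<l. {(c i, c (Suc i mod l)), (c (Suc i mod l), c i)})"
  proof (rule two_regular_cycle[of X F])
    show "finite X" using X_V finV by (rule finite_subset)
    show "X \<noteq> {}" using \<open>s \<in> X\<close> by blast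
    show "card (F `` {x}) = 2" if "x \<in> X" for x
    proof -
      have "cubic x" "h \<in> E `` {x}" using that by (simp_all add: X_def)
      then show ?thesis using F_nbrs[OF that] by simp
    qed
    \<comment> \<open>A proper part of the rim closed under \<open>F\<close> is attached at
      \<open>h\<close> only and misses a cubic vertex \<open>t\<close> of the rim.\<close>
    show "Z = X" if Z: "Z \<subseteq> X" "Z \<noteq> {}" "\<And>z. z \<in> Z \<Longrightarrow> F `` {z} \<subseteq> Z" for Z
    proof (rule ccontr)
      assume "Z \<noteq> X"
      then obtain t where t: "t \<in> X" "t \<notin> Z" using Z(1) by blast
      show False
      proof (rule attached_meets_cubic[of Z h t])
        fix z assume "z \<in> Z"
        then show "E `` {z} \<subseteq> insert h Z" "(z, t) \<notin> E"
          using Z F_nbrs[of z] t \<open>h \<notin> X\<close> by blast+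
      qed (use Z X_V t \<open>h \<notin> X\<close> in \<open>auto simp: X_def\<close>)
    qed
  qed (auto simp: F_def E_irrefl intro: E_sym)
  have "{h} \<times> X = (\<Union>i<l. {(h, c i)})" "X \<times> {h} = (\<Union>i<l. {(c i, h)})"
    unfolding lc(3) by auto
  then have "E = (\<Union>i<l. {(c i, c (Suc i mod l)), (c (Suc i mod l), c i)}) \<union>
      (\<Union>i<l. {(h, c i)}) \<union> (\<Union>i<l. {(c i, h)})"
    using E lc(4) by simp
  also have "\<dots> = (\<Union>i<l. {(c i, c (Suc i mod l)), (c (Suc i mod l), c i), (h, c i), (c i, h)})"
    by blast
  finally show ?thesis
    using wheelI[OF lc(1,2), of h] \<open>h \<notin> X\<close> V lc(3) by blast
qed

lemma prism_if_cubic_triangle: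
  assumes "cubic s" "cubic b" "cubic c" "(s, b) \<in> E" "(s, c) \<in> E" "(b, c) \<in> E" "card V \<noteq> 4"
  shows "prism (with_proj \<lparr>pverts = V, parcs = E\<rparr>)"
proof -
  obtain a b' c' where n: "E `` {s} = {b, c, a}" "E `` {b} = {s, c, b'}" "E `` {c} = {s, b, c'}"
    and d: "distinct [s, b, c, a, b', c']"
    using triangle_partner[OF assms] .
  \<comment> \<open>One application for each vertex of the triangle in the role of the deleted
    vertex yields the opposite triangle.\<close>
  have 1: "cubic a" "(b', c') \<in> E" using prism_step[OF assms(1-3) n d] .
  have 2: "cubic b'" "(a, c') \<in> E"
  proof -
    have "E `` {c} = {b, s, c'}" "distinct [b, s, c, b', a, c']"
      using n(3) d by auto
    then show "cubic b'" "(a, c') \<in> E" using prism_step[OF assms(2,1,3) n(2,1)] by blast+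
  qed
  have 3: "cubic c'" "(a, b') \<in> E"
  proof -
    have "E `` {s} = {c, b, a}" "E `` {b} = {c, s, b'}" "distinct [c, s, b, c', a, b']"
      using n(1,2) d by auto
    then show "cubic c'" "(a, b') \<in> E" using prism_step[OF assms(3,1,2) n(3)] by blast+
  qed
  have adj: "(s, a) \<in> E" "(b, b') \<in> E" "(c, c') \<in> E" using n by auto
  have n': "E `` {a} = {s, b', c'}" "E `` {b'} = {b, a, c'}" "E `` {c'} = {c, a, b'}"
    using 1 2 3 adj E_sym d by (intro card_3_eqI; simp)+
  have "{s, b, c, a, b', c'} = V"
  proof (rule closed_eq_V)
    show "{s, b, c, a, b', c'} \<subseteq> V" using adj in_V by auto
    fix y assume "y \<in> {s, b, c, a, b', c'}"
    then show "E `` {y} \<subseteq> {s, b, c, a, b', c'}"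
      by (elim insertE emptyE) (simp_all add: n n')
  qed simp
  then have V: "V = {s, b, c, a, b', c'}" ..
  show ?thesis
    by (rule prismI[OF d V n]; use n' in \<open>auto\<close>)
qed

lemma wheel_prism_or_complete_bipartite:
  "(\<exists>l. wheel l (with_proj \<lparr>pverts = V, parcs = E\<rparr>)) \<or>
   prism (with_proj \<lparr>pverts = V, parcs = E\<rparr>) \<or>
   complete_bipartite_digraph 3 3 (with_proj \<lparr>pverts = V, parcs = E\<rparr>)"
proof (cases "card V = 4")
  case True
  then show ?thesis using wheel_if_complete by blast
next
  case card: False
  show ?thesis
  proof (cases "\<exists>u v w. cubic u \<and> (u, v) \<in> E \<and> (u, w) \<in> E \<and> (v, w) \<in> E")
    case False
    then interpret cubic_triangle_free_graph V E by unfold_locales blast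
    show ?thesis using complete_bipartite by blast
  next
    case True
    then obtain u v w where uvw: "cubic u" "(u, v) \<in> E" "(u, w) \<in> E" "(v, w) \<in> E" by blast
    then have "v \<noteq> w" using E_irrefl by blast
    \<comment> \<open>At most one neighbour of \<open>u\<close> is not cubic, so \<open>v\<close> or
      \<open>w\<close> can be named \<open>b\<close>. The degree of \<open>c\<close> then decides
      between wheel and prism.\<close>
    then have "\<exists>b c. cubic b \<and> (u, b) \<in> E \<and> (u, c) \<in> E \<and> (b, c) \<in> E"
      using uvw cubic_two_cubic_nbrs[OF uvw(1-3)] E_sym by blast
    then obtain b c where "cubic b" "(u, b) \<in> E" "(u, c) \<in> E" "(b, c) \<in> E" by blast
    then show ?thesis
      using wheel_if_fan[OF uvw(1)] prism_if_cubic_triangle[OF uvw(1)] card by blast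
  qed
qed

end

section \<open>Suppressing vertices of degree two\<close>

lemma (in simple_graph) thick_del_if_degree_4:
  assumes "V - {s} \<noteq> {}" "\<And>v. v \<in> V - {s} \<Longrightarrow> 4 \<le> card (E `` {v})"
  shows "thick (V - {s}) (vertex_del s E)"
proof (rule thick.base[OF assms(1)], rule ballI)
  fix v assume v: "v \<in> V - {s}"
  then have "card (E `` {v}) \<le> card (vertex_del s E `` {v}) + card {s}"
    by (intro card_loss simple_graph.fin_nbrs[OF simple_graph_del]) auto
  then show "3 \<le> card (vertex_del s E `` {v})" using assms(2)[OF v] by simp
qed

text \<open>Subdividing the edge \<open>xy\<close> of the reduced graph by \<open>w\<close> undoes
  the elimination. As \<open>x\<close> and \<open>y\<close> are nonadjacent in \<open>E\<close>,
  that edge is new, so removing it again gives back exactly \<open>E\<close>.\<close>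

lemma suppress_degree_2_vertex:
  assumes "simple_graph V E" "w \<in> V" "E `` {w} = {x, y}" "(x, y) \<notin> E" "x \<noteq> y"
    and "subdivision_pair P \<lparr>pverts = V - {w}, parcs = vertex_elim w E\<rparr>"
  shows "subdivision_pair P \<lparr>pverts = V, parcs = E\<rparr>"
proof -
  interpret simple_graph V E by fact
  note iffs = nbrs_iff[OF assms(3)]
  have neq: "x \<noteq> w" "y \<noteq> w" using nbrs_not_self[OF assms(3)] by auto
  have nadj: "(y, x) \<notin> E" using assms(4) E_sym by blast
  let ?H = "\<lparr>pverts = V - {w}, parcs = vertex_elim w E\<rparr>"
  have "E = vertex_elim w E - {(x, y), (y, x)} \<union> {(x, w), (w, x), (w, y), (y, w)}"
  proof (rule subset_antisym; rule subrelI)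
    fix p q assume pq: "(p, q) \<in> E"
    then have "p \<noteq> q" "(p, q) \<noteq> (x, y)" "(p, q) \<noteq> (y, x)" using E_irrefl nadj assms(4) by blast+
    moreover have "q = x \<or> q = y" if "p = w" using that pq iffs by simp
    moreover have "p = x \<or> p = y" if "q = w" using that pq iffs by simp
    ultimately show "(p, q) \<in> vertex_elim w E - {(x, y), (y, x)} \<union> {(x, w), (w, x), (w, y), (y, w)}"
      using pq by auto
  next
    fix p q assume "(p, q) \<in> vertex_elim w E - {(x, y), (y, x)} \<union> {(x, w), (w, x), (w, y), (y, w)}"
    then show "(p, q) \<in> E" by (auto simp: iffs)
  qed
  then have "subdivide ?H (x, y) w = \<lparr>pverts = V, parcs = E\<rparr>"
    using assms(2) by (auto simp: subdivide.simps)
  moreover have "(x, y) \<in> parcs ?H" using neq iffs assms(5) by simp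
  ultimately show ?thesis
    using subdivision_pair_divide[of "(x, y)" ?H w P] assms(6) by simp
qed

text \<open>Induction along the reductions, with \<open>S\<close> the set of critical vertices that
  may have degree below 4. Suppression removes \<open>w\<close> from \<open>S\<close> and preserves
  both conditions, until minimum degree 3 is reached and the classification applies.\<close>

lemma subdivision_if_critical:
  assumes "thick V E" "simple_graph V E" "S \<subseteq> V" "S \<noteq> {}"
    and "\<forall>s\<in>S. \<not> thick (V - {s}) (vertex_del s E)"
    and "\<forall>v\<in>V - S. 4 \<le> card (E `` {v})"
  shows "\<exists>P. subdivision_pair P \<lparr>pverts = V, parcs = E\<rparr> \<and>
    ((\<exists>l. wheel l (with_proj P)) \<or> prism (with_proj P) \<or>
      complete_bipartite_digraph 3 3 (with_proj P))"
  using assms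
proof (induction V E arbitrary: S rule: thick.induct)
  case (base V E)
  interpret simple_graph V E by (rule base.prems(1))
  obtain s where s: "s \<in> S" "s \<in> V" using base.prems(2,3) by blast
  interpret critical_graph V E
  proof
    show "3 \<le> card (E `` {v})" if "v \<in> V" for v using base.hyps(2) that by blast
    show "\<not> thick (V - {v}) (vertex_del v E)" if "v \<in> V" "card (E `` {v}) = 3" for v
      using that base.prems(4,5) by force
    show "\<exists>v\<in>V. card (E `` {v}) = 3"
    proof (rule ccontr)
      assume "\<not> (\<exists>v\<in>V. card (E `` {v}) = 3)"
      then have ge4: "4 \<le> card (E `` {v})" if "v \<in> V" for v
        using base.hyps(2) that by force
      have "thick (V - {s}) (vertex_del s E)"
      proof (rule thick_del_if_degree_4)
        have "E `` {s} \<noteq> {}" using ge4[OF s(2)] by auto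
        then show "V - {s} \<noteq> {}" using nbrs_sub[of s] E_irrefl by blast
      qed (use ge4 in blast)
      then show False using base.prems(4) s(1) by blast
    qed
  qed
  have "subdivision_pair \<lparr>pverts = V, parcs = E\<rparr> \<lparr>pverts = V, parcs = E\<rparr>"
  proof (rule subdivision_pair_base)
    interpret G: pair_graph "\<lparr>pverts = V, parcs = E\<rparr>" by (rule pair_graph)
    show "pair_bidirected_digraph \<lparr>pverts = V, parcs = E\<rparr>" by unfold_locales
  qed
  then show ?case using wheel_prism_or_complete_bipartite by blast
next
  case (elim w V E)
  interpret simple_graph V E by (rule elim.prems(1))
  note low = \<open>card (E `` {w}) \<le> 2\<close> and w = \<open>w \<in> V\<close> and thick_elim = \<open>thick (V - {w}) (vertex_elim w E)\<close>
  define E' where "E' = vertex_elim w E"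
  have G': "simple_graph (V - {w}) E'" unfolding E'_def by (rule simple_graph_elim)
  note fin' = simple_graph.fin_nbrs[OF G']
  have "w \<in> S" using low elim.prems(5) w by force
  then have not_thick: "\<not> thick (V - {w}) (vertex_del w E)" using elim.prems(4) by blast
  \<comment> \<open>If the neighbours of \<open>w\<close> formed a clique, as they do for degree at
    most 1, elimination would coincide with deletion, against criticality of
    \<open>w\<close>.\<close>
  have "\<exists>x y. (w, x) \<in> E \<and> (w, y) \<in> E \<and> x \<noteq> y \<and> (x, y) \<notin> E"
  proof (rule ccontr)
    assume "\<nexists>x y. (w, x) \<in> E \<and> (w, y) \<in> E \<and> x \<noteq> y \<and> (x, y) \<notin> E"
    then have clique: "(p, q) \<in> E" if "(w, p) \<in> E" "(w, q) \<in> E" "p \<noteq> q" for p q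
      using that by blast
    have "(p, q) \<in> vertex_elim w E \<longleftrightarrow> (p, q) \<in> vertex_del w E" for p q
      using clique[of p q] E_sym[of p w] E_irrefl[of p] by auto
    then have "vertex_elim w E = vertex_del w E" by (auto simp del: in_vertex_elim in_vertex_del)
    then show False using thick_elim not_thick by simp
  qed
  then obtain x y where xy: "(w, x) \<in> E" "(w, y) \<in> E" "x \<noteq> y" "(x, y) \<notin> E" by blast
  have "{x, y} = E `` {w}"
    using low xy by (intro card_seteq) auto
  then have nw: "E `` {w} = {x, y}" ..
  note iffs = nbrs_iff[OF nw]
  have neq: "x \<noteq> w" "y \<noteq> w" using nbrs_not_self[OF nw] by auto
  have deg: "4 \<le> card (E' `` {v})" if v: "v \<in> V - {w}" "4 \<le> card (E `` {v})" for v
  proof -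
    consider "v = x" | "v = y" | "v \<notin> {x, y}" by blast
    then show ?thesis
    proof cases
      case 1
      have "card (E `` {x}) + card {y} \<le> card (E' `` {x}) + card {w}"
        using xy neq iffs E_irrefl by (intro card_exchange fin') (auto simp: E'_def)
      then show ?thesis using v 1 by simp
    next
      case 2
      have "card (E `` {y}) + card {x} \<le> card (E' `` {y}) + card {w}"
        using xy neq iffs E_irrefl E_sym by (intro card_exchange fin') (auto simp: E'_def)
      then show ?thesis using v 2 by simp
    next
      case 3
      then have "(v, w) \<notin> E" by (simp add: iffs)
      then have "E' `` {v} = E `` {v}" using v(1) E_irrefl by (auto simp: E'_def)
      then show ?thesis using v by simp
    qed
  qed
  have "\<exists>P. subdivision_pair P \<lparr>pverts = V - {w}, parcs = vertex_elim w E\<rparr> \<and>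
    ((\<exists>l. wheel l (with_proj P)) \<or> prism (with_proj P) \<or>
      complete_bipartite_digraph 3 3 (with_proj P))"
  proof (rule elim.IH)
    show "simple_graph (V - {w}) (vertex_elim w E)" by (rule simple_graph_elim)
    show "S - {w} \<subseteq> V - {w}" using elim.prems(2) by blast
    \<comment> \<open>Otherwise all vertices but \<open>w\<close> have degree at least 4, and
      deleting \<open>w\<close> would leave a thick graph.\<close>
    show "S - {w} \<noteq> {}"
    proof
      assume "S - {w} = {}"
      then have ge4: "4 \<le> card (E `` {v})" if "v \<in> V - {w}" for v
        using that elim.prems(5) by blast
      have "thick (V - {w}) (vertex_del w E)"
        using in_V[OF xy(1)] neq ge4 by (intro thick_del_if_degree_4) auto
      then show False using not_thick by blast
    qed
    \<comment> \<open>Deleting \<open>s\<close> commutes with eliminating \<open>w\<close>, whose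
      degree stays at most 2, so thickness would lift to the graph without \<open>s\<close>.\<close>
    show "\<forall>s\<in>S - {w}. \<not> thick (V - {w} - {s}) (vertex_del s (vertex_elim w E))"
    proof (intro ballI notI)
      fix s assume s: "s \<in> S - {w}"
      assume "thick (V - {w} - {s}) (vertex_del s (vertex_elim w E))"
      moreover have "V - {w} - {s} = V - {s} - {w}" by blast
      ultimately have thick: "thick (V - {s} - {w}) (vertex_elim w (vertex_del s E))"
        using s by (simp add: vertex_elim_del_commute)
      have "card (vertex_del s E `` {w}) \<le> card (E `` {w})"
        by (intro card_mono) auto
      then have "card (vertex_del s E `` {w}) \<le> 2" using low by simp
      moreover have "w \<in> V - {s}" using w s by blast
      ultimately have "thick (V - {s}) (vertex_del s E)" using thick.elim thick by metis
      then show False using elim.prems(4) s by blast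
    qed
    show "\<forall>v\<in>V - {w} - (S - {w}). 4 \<le> card (vertex_elim w E `` {v})"
      using deg elim.prems(5) unfolding E'_def by blast
  qed
  then show ?case
    using suppress_degree_2_vertex[OF elim.prems(1) w nw xy(4,3)] by blast
qed

section \<open>A maximal connected complement\<close>

lemma out_degree_with_proj: "out_degree (with_proj G) v = card (parcs G `` {v})"
proof -
  have "out_arcs (with_proj G) v = Pair v ` (parcs G `` {v})" by (auto simp: out_arcs_def)
  then show ?thesis by (simp add: out_degree_def card_image inj_on_def)
qed

text \<open>Arcs are symmetric, so any two vertices of \<open>A\<close> are joined through
  \<open>x\<close>.\<close>

lemma (in pair_graph) connected_induce_if_reachable:
  assumes "x \<in> A" "\<And>u. u \<in> A \<Longrightarrow> (x, u) \<in> (parcs G \<inter> A \<times> A)\<^sup>*"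
  shows "Digraph_Component.connected (with_proj G \<restriction> A)"
proof -
  let ?r = "parcs G \<inter> A \<times> A"
  have ends: "arcs_ends (with_proj G \<restriction> A) = ?r"
    by (auto simp: arcs_ends_conv)
  have "sym ?r" using arcs_symmetric by (auto intro: symI)
  have to: "(x, u) \<in> rtrancl_on A ?r" if "u \<in> A" for u
    using assms that by (intro rtrancl_consistent_rtrancl_on) auto
  have "(u, x) \<in> rtrancl_on A ?r" if "u \<in> A" for u
    using symD[OF rtrancl_on_sym[OF \<open>sym ?r\<close>] to[OF that]] .
  then have "(u, v) \<in> rtrancl_on A ?r" if "u \<in> A" "v \<in> A" for u v
    using that to by (meson rtrancl_on_trans)
  moreover have "?r\<^sup>s = ?r" using \<open>sym ?r\<close> by (auto simp: symcl_def sym_conv_converse_eq)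
  ultimately show ?thesis
    using assms(1) unfolding connected_conv ends by auto
qed

lemma (in pair_graph) crossing_arc_if_connected:
  assumes "Digraph_Component.connected (with_proj G)" "x \<in> A" "x \<in> pverts G" "b \<in> pverts G" "b \<notin> A"
  obtains u v where "(u, v) \<in> parcs G" "u \<in> A" "v \<notin> A"
proof -
  have "(x, b) \<in> rtrancl_on (pverts G) ((parcs G)\<^sup>s)"
    using assms unfolding connected_conv by simp
  then have "b \<notin> A \<longrightarrow> (\<exists>u v. (u, v) \<in> parcs G \<and> u \<in> A \<and> v \<notin> A)"
  proof (induction rule: rtrancl_on_induct)
    case (step y z)
    then have "(y, z) \<in> parcs G" using arcs_symmetric by (auto simp: symcl_def)
    then show ?case using step by blast
  qed (use assms(2) in simp)
  then show thesis using that assms(5) by blast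
qed

lemma thick_nonempty: "thick V E \<Longrightarrow> V \<noteq> {}"
  by (induction rule: thick.induct) auto

theorem theorem6:
  fixes G :: "'a pair_pre_digraph" and x :: 'a
  assumes "pair_graph G"
    and "Digraph_Component.connected (with_proj G)"
    and "\<forall>v \<in> pverts G. 4 \<le> out_degree (with_proj G) v"
    and "x \<in> pverts G"
  shows "\<exists>H P :: 'a pair_pre_digraph.
      induced_subgraph (with_proj H) (with_proj G) \<and>
      subdivision_pair P H \<and>
      ((\<exists>l. wheel l (with_proj P)) \<or> prism (with_proj P) \<or>
        complete_bipartite_digraph 3 3 (with_proj P)) \<and>
      Digraph_Component.connected (with_proj G \<restriction> (pverts G - pverts H)) \<and>
      x \<in> pverts G - pverts H"
proof -
  interpret pair_graph G by fact
  define V E where "V = pverts G" and "E = parcs G"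
  interpret VE: simple_graph V E
    by unfold_locales
      (auto simp: V_def E_def pair_finite_verts arcs_symmetric dest: in_arcsD1 in_arcsD2 no_loops')
  have deg: "4 \<le> card (E `` {v})" if "v \<in> V" for v
    using assms(3) that by (simp add: V_def E_def out_degree_with_proj)
  have "x \<in> V" using assms(4) by (simp add: V_def)
  \<comment> \<open>Connectedness of \<open>A\<close> is phrased as reachability from
    \<open>x\<close> inside \<open>A\<close>, which is easily extended by one vertex.\<close>
  define good where "good A \<longleftrightarrow> A \<subseteq> V \<and> x \<in> A \<and> (\<forall>u\<in>A. (x, u) \<in> (E \<inter> A \<times> A)\<^sup>*) \<and>
    thick (V - A) (E \<inter> (V - A) \<times> (V - A))" for A
  have del_eq: "E \<inter> (V - insert s A) \<times> (V - insert s A) = vertex_del s (E \<inter> (V - A) \<times> (V - A))"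
    for s A by auto
  have "good {x}"
  proof -
    have "E \<inter> (V - {x}) \<times> (V - {x}) = vertex_del x E" using VE.E_sub by auto
    moreover have "thick (V - {x}) (vertex_del x E)"
    proof (rule VE.thick_del_if_degree_4)
      have "E `` {x} \<noteq> {}" using deg[OF \<open>x \<in> V\<close>] by auto
      then show "V - {x} \<noteq> {}" using VE.nbrs_sub[of x] VE.E_irrefl by blast
    qed (use deg in blast)
    ultimately show ?thesis using \<open>x \<in> V\<close> by (simp add: good_def)
  qed
  moreover have "\<forall>A. good A \<longrightarrow> card A < Suc (card V)"
    using card_mono[OF VE.finV] by (auto simp: good_def less_Suc_eq_le)
  ultimately obtain A where A: "good A" and max: "\<forall>A'. good A' \<longrightarrow> card A' \<le> card A"
    using ex_has_greatest_nat[of good "{x}" card "Suc (card V)"] by blast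
  have "A \<subseteq> V" "x \<in> A" and reach: "\<And>u. u \<in> A \<Longrightarrow> (x, u) \<in> (E \<inter> A \<times> A)\<^sup>*"
    using A by (auto simp: good_def)
  define B F where "B = V - A" and "F = E \<inter> B \<times> B"
  \<comment> \<open>The vertices of \<open>B\<close> that have lost neighbours to \<open>A\<close>;
    nonempty because \<open>G\<close> is connected.\<close>
  define S where "S = {s \<in> B. \<exists>u\<in>A. (u, s) \<in> E}"
  have "thick B F" using A by (simp add: good_def B_def F_def)
  interpret BF: simple_graph B F
    by unfold_locales (auto simp: B_def F_def VE.finV VE.E_irrefl intro: VE.E_sym)
  have "S \<noteq> {}"
  proof -
    obtain b where "b \<in> B" using thick_nonempty[OF \<open>thick B F\<close>] by blast
    then obtain u v where "(u, v) \<in> E" "u \<in> A" "v \<notin> A"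
      using crossing_arc_if_connected[OF assms(2) \<open>x \<in> A\<close> assms(4), of b]
      by (auto simp: B_def V_def E_def)
    then show ?thesis using VE.in_V by (auto simp: S_def B_def)
  qed
  \<comment> \<open>Otherwise moving \<open>s\<close> into \<open>A\<close> would keep
    \<open>A\<close> connected and contradict its maximality.\<close>
  have not_thick: "\<not> thick (B - {s}) (vertex_del s F)" if sS: "s \<in> S" for s
  proof
    assume thick: "thick (B - {s}) (vertex_del s F)"
    obtain u where u: "u \<in> A" "(u, s) \<in> E" and s: "s \<in> V" "s \<notin> A"
      using sS by (auto simp: S_def B_def)
    have mono: "(E \<inter> A \<times> A)\<^sup>* \<subseteq> (E \<inter> insert s A \<times> insert s A)\<^sup>*" by (intro rtrancl_mono) blast
    have "(x, u) \<in> (E \<inter> insert s A \<times> insert s A)\<^sup>*" using mono reach[OF u(1)] by blast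
    moreover have "(u, s) \<in> E \<inter> insert s A \<times> insert s A" using u by blast
    ultimately have "(x, s) \<in> (E \<inter> insert s A \<times> insert s A)\<^sup>*" by (rule rtrancl_into_rtrancl)
    then have "\<forall>u\<in>insert s A. (x, u) \<in> (E \<inter> insert s A \<times> insert s A)\<^sup>*"
      using mono reach by blast
    moreover have "V - insert s A = B - {s}" by (auto simp: B_def)
    then have "thick (V - insert s A) (E \<inter> (V - insert s A) \<times> (V - insert s A))"
      using thick unfolding del_eq by (simp add: F_def B_def)
    ultimately have "good (insert s A)"
      using s(1) \<open>A \<subseteq> V\<close> \<open>x \<in> A\<close> by (simp add: good_def)
    then have "card (insert s A) \<le> card A" using max by blast
    then show False using s finite_subset[OF \<open>A \<subseteq> V\<close> VE.finV] by simp
  qed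
  have high: "4 \<le> card (F `` {v})" if "v \<in> B - S" for v
  proof -
    have "F `` {v} = E `` {v}"
      using that VE.in_V VE.E_sym by (auto simp: F_def B_def S_def)
    then show ?thesis using deg that by (simp add: B_def)
  qed
  define H where "H = \<lparr>pverts = B, parcs = F\<rparr>"
  obtain P where P: "subdivision_pair P H"
    "(\<exists>l. wheel l (with_proj P)) \<or> prism (with_proj P) \<or> complete_bipartite_digraph 3 3 (with_proj P)"
    using subdivision_if_critical[OF \<open>thick B F\<close> BF.simple_graph_axioms, of S]
      \<open>S \<noteq> {}\<close> not_thick high by (auto simp: S_def H_def)
  have "pverts G - pverts H = A" using \<open>A \<subseteq> V\<close> by (auto simp: H_def B_def V_def)
  moreover have "Digraph_Component.connected (with_proj G \<restriction> A)"
    using reach \<open>x \<in> A\<close> unfolding E_def by (rule connected_induce_if_reachable[rotated])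
  moreover have "induced_subgraph (with_proj H) (with_proj G)"
  proof -
    interpret H: pair_graph H unfolding H_def by (rule BF.pair_graph)
    show ?thesis
      unfolding induced_subgraph_def subgraph_def
      using wf_digraph_axioms H.wf_digraph_axioms
      by (auto simp: H_def B_def F_def V_def E_def compatible_def)
  qed
  ultimately show ?thesis using P \<open>x \<in> A\<close> by blast
qed

end
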